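(* Let $R$ be a complete discrete valuation ring with normalized valuation $v_R$, whose residue field is finite with $q$ elements, and let $d\geqslant 1$. Set $$E(q,d)=\sum_{v=1}^{\infty}\bigl[1-(1-q^{-v})^d\bigr].$$ Then the random variable $V_L$ on $\Omega=M_d(R)$ (equipped with its Haar probability measure) satisfies $$E(q,d)-\frac{1}{q-1}<\mathbb{E}[V_L]\leqslant E(q,d).$$ Furthermore, $|E(q,d)-\log_q d|\leqslant \frac{1}{\log 2}$, and $|E(q,d)-\log_q d|\leqslant 1$ if $q\geqslant 3$ (here $\log$ is the natural logarithm).
   Context: $R$ is a complete discrete valuation ring with fraction field $K$, valuation $v_R:R\to\mathbb{N}\cup\{\infty\}$ normalized so that it is surjective, uniformizer $\pi$ ($v_R(\pi)=1$), and finite residue field of cardinality $q$; $v_R$ is extended to $K$. $\Omega=M_d(R)$ is the ring of $d\times d$ matrices over $R$, endowed with its Haar measure normalized to be a probability measure (equivalently, the entries are independent and Haar-distributed in $R$). A matrix $M\in M_d(K)$ admits an LU decomposition if $M=L(M)U(M)$ with $L(M)$ unit lower triangular (diagonal entries equal to $1$) with entries in $K$ and $U(M)$ upper triangular with entries in $K$; for invertible $M$ this exists iff all leading principal minors are nonzero, and is then unique. For $\omega\in\Omega$ such that $L(\omega)$ is defined (which holds almost surely), $V_L(\omega)$ is the opposite of the smallest valuation of an entry of $L(\omega)$.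
   Formalization: The strict lower bound E(q,d) − 1/(q−1) < E[V_L] fails for d = 1 and d = 2, where equality holds; the formal theorem states ≤ for all d ≥ 1 and the strict inequality for d ≥ 3. *)

theory Defs
  imports
    "HOL-Probability.Probability"
    "HOL-Computational_Algebra.Polynomial_Factorial"
    "Jordan_Normal_Form.Matrix"
begin

text \<open>
  The ring \<open>R\<close> is the whole type \<open>'r\<close>, its fraction field \<open>K\<close> is the type \<open>'r fract\<close>, and \<open>v\<close> is
  the normalized valuation on \<open>R\<close>.  The assumption \<open>val_dvd\<close> says that \<open>R\<close> contains every element
  \<open>y / x\<close> of \<open>K\<close> of nonnegative valuation, i.e. that \<open>R\<close> is the full valuation ring.
\<close>

locale complete_dvr =
  fixes v :: "'r::idom \<Rightarrow> enat"
  assumes val_surj: "surj v"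
    and val_eq_infinity: "v x = \<infinity> \<longleftrightarrow> x = 0"
    and val_mult: "v (x * y) = v x + v y"
    and val_add: "min (v x) (v y) \<le> v (x + y)"
    and val_dvd: "v x \<le> v y \<Longrightarrow> x dvd y"
    and val_complete:
      "\<And>X :: nat \<Rightarrow> 'r. (\<And>n::nat. \<exists>N. \<forall>i\<ge>N. \<forall>j\<ge>N. enat n \<le> v (X i - X j))
        \<Longrightarrow> \<exists>l. \<forall>n::nat. \<exists>N. \<forall>i\<ge>N. enat n \<le> v (X i - l)"

text \<open>The underlying set of the residue field, as the set of cosets of the maximal ideal.\<close>

definition residue_field :: "('r::idom \<Rightarrow> enat) \<Rightarrow> 'r set set" where
  "residue_field v = UNIV // {(x, y). 0 < v (x - y)}"

text \<open>
  The extension of \<open>v\<close> to \<open>K\<close>, with values in the integers and infinity, seen inside \<open>ereal\<close>.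
  The value does not depend on the fraction; see \<open>valK_Fract\<close>.
\<close>

definition valK :: "('r::idom \<Rightarrow> enat) \<Rightarrow> 'r fract \<Rightarrow> ereal" where
  "valK v x = (THE w. \<exists>a b. b \<noteq> 0 \<and> x = Fraction_Field.Fract a b \<and>
                 w = ereal_of_enat (v a) - ereal_of_enat (v b))"

lemma (in complete_dvr) valK_Fract:
  assumes "b \<noteq> 0"
  shows "valK v (Fraction_Field.Fract a b) = ereal_of_enat (v a) - ereal_of_enat (v b)"
  unfolding valK_def
proof (rule the_equality)
  fix w
  assume "\<exists>a' b'. b' \<noteq> 0 \<and> Fraction_Field.Fract a b = Fraction_Field.Fract a' b' \<and>
            w = ereal_of_enat (v a') - ereal_of_enat (v b')"
  then obtain a' b' where b': "b' \<noteq> 0" and eq: "Fraction_Field.Fract a b = Fraction_Field.Fract a' b'"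
    and w: "w = ereal_of_enat (v a') - ereal_of_enat (v b')" by blast
  from eq b' assms have "a * b' = a' * b" by (simp add: eq_fract)
  then have "v a + v b' = v a' + v b" by (metis val_mult)
  moreover from assms b' obtain m n where "v b = enat m" "v b' = enat n"
    using val_eq_infinity by (metis not_infinity_eq)
  ultimately show "w = ereal_of_enat (v a) - ereal_of_enat (v b)"
    unfolding w by (cases "v a"; cases "v a'") auto
qed (use assms in blast)

text \<open>An LU decomposition: unit lower triangular times upper triangular.\<close>

definition LU_decomp :: "nat \<Rightarrow> 'a::field mat \<Rightarrow> 'a mat \<Rightarrow> 'a mat \<Rightarrow> bool" where
  "LU_decomp d M L U \<longleftrightarrow>
     L \<in> carrier_mat d d \<and> U \<in> carrier_mat d d \<and>
     (\<forall>i<d. L $$ (i, i) = 1) \<and> (\<forall>i<d. \<forall>j<d. i < j \<longrightarrow> L $$ (i, j) = 0) \<and>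
     upper_triangular U \<and> M = L * U"

text \<open>
  \<open>L(M)\<close> is regarded as defined when \<open>M\<close> has exactly one LU decomposition
  (\<open>L\<close> is invertible, so \<open>M\<close> and \<open>L\<close> determine \<open>U\<close>).
\<close>

definition L_defined :: "nat \<Rightarrow> 'a::field mat \<Rightarrow> bool" where
  "L_defined d M \<longleftrightarrow> (\<exists>!L. \<exists>U. LU_decomp d M L U)"

definition L_part :: "nat \<Rightarrow> 'a::field mat \<Rightarrow> 'a mat" where
  "L_part d M = (THE L. \<exists>U. LU_decomp d M L U)"

text \<open>
  The value 0 where \<open>L\<close> is undefined is a convention on a null set.
\<close>

definition V_L :: "('r::idom \<Rightarrow> enat) \<Rightarrow> nat \<Rightarrow> 'r mat \<Rightarrow> real" where
  "V_L v d \<omega> =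
     (if L_defined d (map_mat to_fract \<omega>)
      then real_of_ereal
             (- Min {valK v (L_part d (map_mat to_fract \<omega>) $$ (i, j)) | i j. i < d \<and> j < d})
      else 0)"

text \<open>Open sets of \<open>M\<^sub>d(R)\<close> in the product of the valuation topologies on the entries.\<close>

definition mat_open :: "('r::idom \<Rightarrow> enat) \<Rightarrow> nat \<Rightarrow> 'r mat set \<Rightarrow> bool" where
  "mat_open v d S \<longleftrightarrow>
     S \<subseteq> carrier_mat d d \<and>
     (\<forall>A\<in>S. \<exists>n::nat. \<forall>B\<in>carrier_mat d d.
        (\<forall>i<d. \<forall>j<d. enat n \<le> v (B $$ (i, j) - A $$ (i, j))) \<longrightarrow> B \<in> S)"

definition haar_prob :: "('r::idom \<Rightarrow> enat) \<Rightarrow> nat \<Rightarrow> 'r mat measure \<Rightarrow> bool" where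
  "haar_prob v d \<mu> \<longleftrightarrow>
     prob_space \<mu> \<and> space \<mu> = carrier_mat d d \<and>
     sets \<mu> = sigma_sets (carrier_mat d d) {S. mat_open v d S} \<and>
     (\<forall>A\<in>carrier_mat d d. \<forall>S\<in>sets \<mu>. emeasure \<mu> ((\<lambda>B. A + B) ` S) = emeasure \<mu> S)"

definition E :: "nat \<Rightarrow> nat \<Rightarrow> real" where
  "E q d = (\<Sum>n. 1 - (1 - 1 / real q ^ Suc n) ^ d)"

end

theory Submission
  imports Defs
begin

text \<open>
  Column \<open>j\<close> of \<open>L\<close> is proportional to \<open>M w\<^sub>j\<close>, where \<open>w\<^sub>j\<close> is a nonzero vector over \<open>R\<close>, supported on the
  coordinates up to \<open>j\<close>, orthogonal to the rows of \<open>M\<close> before row \<open>j\<close> and determined by these rows.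
  Let \<open>a\<^sub>j\<close> be the valuation of the content of \<open>w\<^sub>j\<close>.  Given the other rows, the product of a row
  with \<open>w\<^sub>j\<close> has valuation \<open>a\<^sub>j\<close> plus a geometric variable, because the Haar measure is invariant under
  translation of that row.  So the variables \<open>X\<^sub>j = v(row\<^sub>j w\<^sub>j) - a\<^sub>j\<close> are independent and geometric,
  and \<open>V\<^sub>L\<close> is at most the maximum of the \<open>X\<^sub>j\<close> over all columns except the last one, which gives the
  upper bound.  Conversely, if the maximum is attained at \<open>J\<close>, the last row alone shows
  \<open>V\<^sub>L \<ge> X\<^sub>J - min(X\<^sub>J, Y)\<close>, where \<open>Y = v(row\<^sub>d w\<^sub>J) - a\<^sub>J\<close> is geometric and independent of \<open>X\<^sub>J\<close>.
  The expected loss is therefore \<open>\<Sum>\<^sub>n q\<^sup>-\<^sup>n (1 - (1 - q\<^sup>-\<^sup>n)\<^sup>d\<^sup>-\<^sup>1)\<close>, which leaves exactly \<open>E(q, d) - 1 / (q - 1)\<close>.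
  The comparison of \<open>E(q, d)\<close> with \<open>log\<^sub>q d\<close> is an integral test with the explicit primitive
  \<open>\<Sum>\<^sub>k (1 - q\<^sup>-\<^sup>t)\<^sup>k / (k ln q)\<close> of the summand, whose total increase is \<open>H\<^sub>d / ln q\<close> with \<open>H\<^sub>d\<close> the
  harmonic number.
\<close>

section \<open>The function E\<close>

text \<open>The summand decreases, so each term lies between consecutive unit increments of the
  primitive \<open>F\<close>. The upper error comes from \<open>harm d \<le> ln d + 1\<close>. The
  lower error is the increment of \<open>F\<close> over [0, 1], lost because the sum starts at
  exponent 1.\<close>

lemma E_bounds:
  fixes q d :: nat
  assumes q: "q \<ge> 2" and d: "d \<ge> 1"
  shows "summable (\<lambda>n. 1 - (1 - 1 / real q ^ Suc n) ^ d)"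
    and "log q d - 1 \<le> E q d" and "E q d \<le> log q d + 1 / ln q"
proof -
  define f :: "real \<Rightarrow> real" where "f t = 1 - (1 - real q powr (- t)) ^ d" for t
  define F :: "real \<Rightarrow> real" where
    "F t = (\<Sum>k<d. (1 - real q powr (- t)) ^ Suc k / real (Suc k)) / ln q" for t
  have lnq: "ln (real q) > 0" using q by simp
  have F': "(F has_real_derivative f t) (at t)" for t
  proof -
    have "((\<lambda>t. 1 - real q powr (- t)) has_real_derivative ln q * real q powr (- t)) (at t)"
      using q by (auto intro!: derivative_eq_intros)
    then have "((\<lambda>t. (1 - real q powr (- t)) ^ Suc k / real (Suc k)) has_real_derivative
        (1 - real q powr (- t)) ^ k * (ln q * real q powr (- t))) (at t)" for k
      by (rule DERIV_cong[OF DERIV_cdivide[OF DERIV_power]]) (simp add: field_simps del: of_nat_Suc)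
    \<comment> \<open>Differentiation leaves a geometric sum with ratio 1 - q^(-t); multiplied by
      q^(-t), which is one minus that ratio, it collapses to \<open>f t\<close>.\<close>
    then have "(F has_real_derivative
        (\<Sum>k<d. (1 - real q powr (- t)) ^ k * (ln q * real q powr (- t))) / ln q) (at t)"
      unfolding F_def by (intro DERIV_cdivide DERIV_sum)
    moreover have "(\<Sum>k<d. (1 - real q powr (- t)) ^ k * (ln q * real q powr (- t))) / ln q
        = real q powr (- t) * (\<Sum>k<d. (1 - real q powr (- t)) ^ k)"
      using lnq by (simp add: sum_distrib_left sum_divide_distrib mult_ac)
    moreover have "\<dots> = f t"
      using one_diff_power_eq[of "1 - real q powr (- t)" d] by (simp add: f_def)
    ultimately show ?thesis by simp
  qed
  have powr_le: "real q powr (- t) \<le> 1" if "t \<ge> 0" for t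
    using q that powr_mono[of "- t" 0 "real q"] by simp
  have f_antimono: "f y \<le> f x" if "0 \<le> x" "x \<le> y" for x y
    unfolding f_def using that powr_le[of x] q
    by (auto intro!: power_mono powr_mono)
  have step: "f (t + 1) \<le> F (t + 1) - F t" "F (t + 1) - F t \<le> f t" if "t \<ge> 0" for t
  proof -
    obtain z where z: "t < z" "z < t + 1" "F (t + 1) - F t = (t + 1 - t) * f z"
      using MVT2[of t "t + 1" F f] F' by auto
    then show "f (t + 1) \<le> F (t + 1) - F t" "F (t + 1) - F t \<le> f t"
      using f_antimono[of t z] f_antimono[of z "t + 1"] that by auto
  qed
  have F0: "F 0 = 0" using q by (simp add: F_def)
  \<comment> \<open>The increment over [0, 1] is at most \<open>f 0\<close>, which is 1 because
    \<open>d\<close> is positive.\<close>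
  have F1: "F 1 \<le> 1"
    using step(2)[of 0] F0 q d by (auto simp: f_def power_0_left)
  have f_term: "1 - (1 - 1 / real q ^ Suc n) ^ d = f (real n + 1)" for n
  proof -
    have "real q powr (- (real n + 1)) = 1 / real q ^ Suc n"
      using q powr_realpow[of "real q" "Suc n"] by (simp only: powr_minus_divide) (simp add: add.commute)
    then show ?thesis unfolding f_def by simp
  qed
  have nonneg: "0 \<le> f t" if "t \<ge> 0" for t
    using powr_le[OF that] q by (simp add: f_def power_le_one)
  have up: "(\<Sum>n<N. f (real n + 1)) \<le> F N" for N
  proof (induction N)
    case (Suc N)
    then show ?case using step(1)[of "real N"] by (simp add: algebra_simps)
  qed (simp add: F0)
  have lo: "F (real N + 1) - F 1 \<le> (\<Sum>n<N. f (real n + 1))" for N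
  proof (induction N)
    case (Suc N)
    then show ?case using step(2)[of "real N + 1"] by (simp add: algebra_simps)
  qed simp
  have lim: "F \<longlonglongrightarrow> harm d / ln q"
  proof -
    have "(\<lambda>N. real q powr (- real N)) \<longlonglongrightarrow> 0"
    proof -
      have "(\<lambda>N. (1 / real q) ^ N) \<longlonglongrightarrow> 0"
        using q by (intro LIMSEQ_power_zero) auto
      moreover have "real q powr (- real N) = (1 / real q) ^ N" for N
        using q powr_realpow[of "real q" N] by (simp add: powr_minus_divide power_one_over)
      ultimately show ?thesis by simp
    qed
    then have "(\<lambda>N. F (real N)) \<longlonglongrightarrow> (\<Sum>k<d. (1 - 0) ^ Suc k / real (Suc k)) / ln q"
      unfolding F_def by (intro tendsto_intros) (use lnq in auto)
    then show ?thesis by (simp add: harm_altdef divide_inverse)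
  qed
  have F_mono: "F N \<le> F (real N + 1)" for N :: nat
    using step(1)[of "real N"] nonneg[of "real N + 1"] by simp
  have F_le: "F N \<le> harm d / ln q" for N :: nat
  proof (rule incseq_le[OF _ lim])
    show "incseq (\<lambda>n. F (real n))"
      by (rule incseq_SucI) (use F_mono in \<open>auto simp: add.commute\<close>)
  qed
  have summ: "summable (\<lambda>n. f (real n + 1))"
  proof (rule summableI_nonneg_bounded)
    show "(\<Sum>n<N. f (real n + 1)) \<le> harm d / ln q" for N
      using up[of N] F_le[of N] by linarith
  qed (use nonneg in auto)
  then show "summable (\<lambda>n. 1 - (1 - 1 / real q ^ Suc n) ^ d)" unfolding f_term .
  have E: "E q d = (\<Sum>n. f (real n + 1))" unfolding E_def f_term ..
  have "E q d \<le> harm d / ln q"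
    unfolding E
  proof (rule suminf_le_const[OF summ])
    show "(\<Sum>n<N. f (real n + 1)) \<le> harm d / ln q" for N
      using up[of N] F_le[of N] by linarith
  qed
  \<comment> \<open>The difference \<open>harm n - ln n\<close> decreases from its value 1 at n =
    1.\<close>
  moreover have "harm d \<le> ln d + 1"
    using decseqD[OF decseq_harm_diff_ln, of 0 "d - 1"] d by (simp add: harm_expand)
  ultimately show "E q d \<le> log q d + 1 / ln q"
    using lnq by (simp add: log_def field_simps)
  have "harm d / ln q - F 1 \<le> E q d"
    unfolding E
  proof (rule LIMSEQ_le)
    show "(\<lambda>N. F (real N + 1) - F 1) \<longlonglongrightarrow> harm d / ln q - F 1"
      using LIMSEQ_Suc[OF lim] by (intro tendsto_intros) (simp add: add.commute)
    show "(\<lambda>N. \<Sum>n<N. f (real n + 1)) \<longlonglongrightarrow> (\<Sum>n. f (real n + 1))"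
      using summ by (rule summable_LIMSEQ)
  qed (use lo in blast)
  moreover have "ln d \<le> harm d"
    using ln_le_harm[of d] d ln_mono[of "real d" "real d + 1"] by linarith
  then have "ln d / ln q \<le> harm d / ln q" using lnq by (simp add: divide_right_mono)
  ultimately show "log q d - 1 \<le> E q d"
    using F1 by (simp add: log_def)
qed

section \<open>LU decompositions\<close>

lemma unit_lower_triangular_solve:
  fixes L :: "nat \<Rightarrow> nat \<Rightarrow> 'a::comm_ring_1"
  assumes "\<And>i. i < d \<Longrightarrow> L i i = 1" "\<And>i j. i < j \<Longrightarrow> j < d \<Longrightarrow> L i j = 0"
  shows "\<exists>x. \<forall>i<d. (\<Sum>k<d. L i k * x k) = b i"
  using assms
proof (induction d)
  case (Suc d)
  then obtain x where x: "\<And>i. i < d \<Longrightarrow> (\<Sum>k<d. L i k * x k) = b i" by auto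
  define y where "y = x(d := b d - (\<Sum>k<d. L d k * x k))"
  have "(\<Sum>k<Suc d. L i k * y k) = b i" if "i < Suc d" for i
    using that x[of i] Suc.prems by (cases "i = d") (auto simp: y_def)
  then show ?case by blast
qed simp

text \<open>Forward substitution: equation i involves only the unknowns up to i, so the first n
  equations already fix the first n unknowns. The case n < d serves where nothing is known about the
  later equations.\<close>

lemma unit_lower_triangular_inj:
  fixes L :: "nat \<Rightarrow> nat \<Rightarrow> 'a::comm_ring_1"
  assumes L1: "\<And>i. i < d \<Longrightarrow> L i i = 1" and L0: "\<And>i j. i < j \<Longrightarrow> j < d \<Longrightarrow> L i j = 0"
    and eq: "\<And>i. i < n \<Longrightarrow> (\<Sum>k<d. L i k * x k) = (\<Sum>k<d. L i k * y k)"
    and "i < n" "n \<le> d"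
  shows "x i = y i"
  using \<open>i < n\<close>
proof (induction i rule: less_induct)
  case (less i)
  have split: "(\<Sum>k<d. L i k * z k) = z i + (\<Sum>k<i. L i k * z k)" for z :: "nat \<Rightarrow> 'a"
  proof -
    have "(\<Sum>k<d. L i k * z k) = (\<Sum>k<Suc i. L i k * z k)"
      using less.prems \<open>n \<le> d\<close> L0 by (intro sum.mono_neutral_right) auto
    then show ?thesis using L1[of i] less.prems \<open>n \<le> d\<close> by (simp add: add.commute)
  qed
  have "(\<Sum>k<i. L i k * x k) = (\<Sum>k<i. L i k * y k)"
    using less by (intro sum.cong) auto
  then show ?case using eq[OF less.prems] split[of x] split[of y] by simp
qed

lemma LU_decompI:
  fixes M L U :: "'a::field mat"
  assumes "M \<in> carrier_mat d d" "L \<in> carrier_mat d d" "U \<in> carrier_mat d d"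
    and "\<And>i. i < d \<Longrightarrow> L $$ (i, i) = 1" "\<And>i j. i < j \<Longrightarrow> j < d \<Longrightarrow> L $$ (i, j) = 0"
    and "\<And>i j. j < i \<Longrightarrow> i < d \<Longrightarrow> U $$ (i, j) = 0"
    and "\<And>i j. i < d \<Longrightarrow> j < d \<Longrightarrow> M $$ (i, j) = (\<Sum>k<d. L $$ (i, k) * U $$ (k, j))"
  shows "LU_decomp d M L U"
  unfolding LU_decomp_def using assms
  by (auto simp: upper_triangular_def scalar_prod_def lessThan_atLeast0 intro!: eq_matI)

lemma LU_decompD:
  fixes M L U :: "'a::field mat"
  assumes "LU_decomp d M L U"
  shows "L \<in> carrier_mat d d" "U \<in> carrier_mat d d"
    and "\<And>i. i < d \<Longrightarrow> L $$ (i, i) = 1" "\<And>i j. i < j \<Longrightarrow> j < d \<Longrightarrow> L $$ (i, j) = 0"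
    and "\<And>i j. j < i \<Longrightarrow> i < d \<Longrightarrow> U $$ (i, j) = 0"
    and "\<And>i j. i < d \<Longrightarrow> j < d \<Longrightarrow> M $$ (i, j) = (\<Sum>k<d. L $$ (i, k) * U $$ (k, j))"
  using assms unfolding LU_decomp_def
  by (auto simp: upper_triangular_def scalar_prod_def lessThan_atLeast0)

text \<open>
  The zero pivot leaves row \<open>j\<close> of \<open>U\<close> supported to the right of the diagonal, so it can be
  subtracted from the next row of \<open>U\<close> while the corresponding columns of \<open>L\<close> are added.
\<close>
lemma L_defined_pivot_nonzero:
  fixes M L U :: "'a::field mat"
  assumes M: "M \<in> carrier_mat d d" and def: "L_defined d M" and LU: "LU_decomp d M L U"
    and j: "Suc j < d"
  shows "U $$ (j, j) \<noteq> 0"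
proof
  assume U0: "U $$ (j, j) = 0"
  note D = LU_decompD[OF LU]
  define L' where "L' = mat d d (\<lambda>(a, b). L $$ (a, b) + (if b = j then L $$ (a, Suc j) else 0))"
  define U' where "U' = mat d d (\<lambda>(a, b). U $$ (a, b) - (if a = Suc j then U $$ (j, b) else 0))"
  have "LU_decomp d M L' U'"
  proof (rule LU_decompI[OF M])
    fix a b assume ab: "a < d" "b < d"
    have "(\<Sum>k<d. L' $$ (a, k) * U' $$ (k, b)) =
       (\<Sum>k<d. L $$ (a, k) * U $$ (k, b)
         + (if k = j then L $$ (a, Suc j) * U $$ (j, b) else 0)
         - (if k = Suc j then L $$ (a, Suc j) * U $$ (j, b) else 0))"
      using ab by (intro sum.cong) (auto simp: L'_def U'_def algebra_simps)
    also have "\<dots> = (\<Sum>k<d. L $$ (a, k) * U $$ (k, b))"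
      using j by (simp add: sum.distrib sum_subtractf)
    finally show "M $$ (a, b) = (\<Sum>k<d. L' $$ (a, k) * U' $$ (k, b))"
      using D(6)[OF ab] by simp
  next
    fix a b assume "b < a" "a < d"
    moreover have "U $$ (j, b) = 0" if "a = Suc j"
      using that \<open>b < a\<close> U0 D(5)[of b j] j by (cases "b = j") auto
    ultimately show "U' $$ (a, b) = 0" using D(5)[of b a] by (auto simp: U'_def)
  qed (use D j in \<open>auto simp: L'_def U'_def\<close>)
  with LU def have "L' = L" unfolding L_defined_def by blast
  \<comment> \<open>By construction this entry grew by the diagonal entry of \<open>L\<close> in
    column \<open>Suc j\<close>, which is 1.\<close>
  then have "L' $$ (Suc j, j) = L $$ (Suc j, j)" by simp
  then show False using j D(3)[of "Suc j"] by (simp add: L'_def)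
qed

text \<open>
  The vectors \<open>W j\<close> are, up to scaling, the columns of \<open>U\<^sup>-\<^sup>1\<close>.
\<close>
locale LU_kernel =
  fixes d :: nat and M :: "'a::field mat" and W :: "nat \<Rightarrow> nat \<Rightarrow> 'a" and p :: "nat \<Rightarrow> 'a"
  assumes M: "M \<in> carrier_mat d d"
    and supp: "j < k \<Longrightarrow> k < d \<Longrightarrow> W j k = 0"
    and diag: "j < d \<Longrightarrow> W j j = (\<Prod>k<j. p k)"
    and ker: "i < j \<Longrightarrow> j < d \<Longrightarrow> (\<Sum>k<d. M $$ (i, k) * W j k) = 0"
    and pivot: "j < d \<Longrightarrow> (\<Sum>k<d. M $$ (j, k) * W j k) = p j"
begin

text \<open>Put T = U W_j, so that L T = M W_j. Triangularity of U and the support of W_j kill T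
  beyond j; the vanishing of the first j entries of M W_j kills it before j. Only T_j survives, and
  L T is a multiple of column j of L.\<close>

lemma LU_mult:
  assumes LU: "LU_decomp d M L U" and "i < d" "j < d"
  shows "L $$ (i, j) * (U $$ (j, j) * W j j) = (\<Sum>k<d. M $$ (i, k) * W j k)"
proof -
  note D = LU_decompD[OF LU]
  define T where "T l = (\<Sum>k<d. U $$ (l, k) * W j k)" for l
  have T: "(\<Sum>l<d. L $$ (a, l) * T l) = (\<Sum>k<d. M $$ (a, k) * W j k)" if "a < d" for a
  proof -
    have "(\<Sum>l<d. L $$ (a, l) * T l) = (\<Sum>l<d. \<Sum>k<d. L $$ (a, l) * U $$ (l, k) * W j k)"
      by (simp add: T_def sum_distrib_left mult.assoc)
    also have "\<dots> = (\<Sum>k<d. \<Sum>l<d. L $$ (a, l) * U $$ (l, k) * W j k)" by (rule sum.swap)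
    also have "\<dots> = (\<Sum>k<d. M $$ (a, k) * W j k)"
      using that by (intro sum.cong) (auto simp: D(6) sum_distrib_right)
    finally show ?thesis .
  qed
  have upper: "T l = 0" if "j < l" "l < d" for l
    unfolding T_def using that D(5)[of _ l] supp[of j]
    by (intro sum.neutral) (metis lessThan_iff mult_eq_0_iff not_less_iff_gr_or_eq less_trans)
  have lower: "T l = 0" if "l < j" for l
    using unit_lower_triangular_inj[of d "\<lambda>a b. L $$ (a, b)" j T "\<lambda>_. 0" l]
      D(3,4) T ker \<open>j < d\<close> that by auto
  have "T j = (\<Sum>k\<in>{j}. U $$ (j, k) * W j k)"
    unfolding T_def using \<open>j < d\<close> D(5)[of _ j] supp[of j]
    by (intro sum.mono_neutral_right) (auto simp: neq_iff)
  then have Tj: "T j = U $$ (j, j) * W j j" by simp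
  have "(\<Sum>l<d. L $$ (i, l) * T l) = (\<Sum>l\<in>{j}. L $$ (i, l) * T l)"
    using \<open>j < d\<close> upper lower by (intro sum.mono_neutral_right) (auto simp: neq_iff)
  then show ?thesis using T[OF \<open>i < d\<close>] Tj by simp
qed

text \<open>A unit lower triangular matrix has no freedom in its last column. Writing that column
  out avoids dividing by the last pivot, which may vanish.\<close>

definition Lmat :: "'a mat" where
  "Lmat = mat d d (\<lambda>(i, j). if Suc j < d then (\<Sum>k<d. M $$ (i, k) * W j k) / p j
                             else if i = j then 1 else 0)"

lemma W_diag_nonzero: "(\<And>j. Suc j < d \<Longrightarrow> p j \<noteq> 0) \<Longrightarrow> j < d \<Longrightarrow> W j j \<noteq> 0"
  by (auto simp: diag)

lemma LU_unique:
  assumes p: "\<And>j. Suc j < d \<Longrightarrow> p j \<noteq> 0" and LU: "LU_decomp d M L U"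
  shows "L = Lmat"
proof (rule eq_matI)
  note D = LU_decompD[OF LU]
  fix i j assume "i < dim_row Lmat" "j < dim_col Lmat"
  then have ij: "i < d" "j < d" by (auto simp: Lmat_def)
  show "L $$ (i, j) = Lmat $$ (i, j)"
  proof (cases "Suc j < d")
    case True
    have "U $$ (j, j) * W j j = p j"
      using LU_mult[OF LU ij(2) ij(2)] D(3) pivot ij by simp
    then have "L $$ (i, j) * p j = (\<Sum>k<d. M $$ (i, k) * W j k)"
      using LU_mult[OF LU ij] by simp
    then show ?thesis using True p[OF True] ij by (simp add: Lmat_def field_simps)
  next
    case False
    then show ?thesis using ij D(3,4)[of i] by (cases "i = j") (auto simp: Lmat_def)
  qed
qed (use LU_decompD(1)[OF LU] in \<open>auto simp: Lmat_def\<close>)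

text \<open>Forward substitution solves Lmat X = M. Since Lmat is injective, X W_a = p_a e_a, so row
  i of X is orthogonal to every W_a with a < i. The W_a are triangular with nonzero diagonal, so the
  entries of X to the left of the diagonal vanish one after another.\<close>

lemma LU_exists:
  assumes p: "\<And>j. Suc j < d \<Longrightarrow> p j \<noteq> 0"
  shows "\<exists>U. LU_decomp d M Lmat U"
proof -
  have L1: "Lmat $$ (i, i) = 1" if "i < d" for i
    using that p[of i] pivot by (auto simp: Lmat_def)
  have L0: "Lmat $$ (i, j) = 0" if "i < j" "j < d" for i j
    using that ker[of i j] by (auto simp: Lmat_def)
  \<comment> \<open>The multiplied form also covers the last column, whose pivot may be zero: there
    \<open>ker\<close> and \<open>pivot\<close> supply the entries.\<close>
  have Lp: "Lmat $$ (i, j) * p j = (\<Sum>k<d. M $$ (i, k) * W j k)" if "i < d" "j < d" for i j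
  proof (cases "Suc j < d")
    case True
    then show ?thesis using that p[OF True] by (simp add: Lmat_def)
  next
    case False
    then show ?thesis using that ker[of i j] pivot[of j] by (cases "i = j") (auto simp: Lmat_def)
  qed
  have "\<exists>x. \<forall>i<d. (\<Sum>k<d. Lmat $$ (i, k) * x k) = M $$ (i, j)" for j
    by (rule unit_lower_triangular_solve) (use L1 L0 in auto)
  then obtain x where x: "(\<Sum>k<d. Lmat $$ (i, k) * x j k) = M $$ (i, j)" if "i < d" for i j
    by metis
  have "LU_decomp d M Lmat (mat d d (\<lambda>(i, j). x j i))"
  proof (rule LU_decompI[OF M])
    fix i j assume ij: "j < i" "i < d"
    have "(\<Sum>k<d. x k i * W a k) = 0" if "a < i" for a
    proof -
      have "(\<Sum>l<d. Lmat $$ (b, l) * (\<Sum>k<d. x k l * W a k)) =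
            (\<Sum>l<d. Lmat $$ (b, l) * (if l = a then p a else 0))" if "b < d" for b
      proof -
        have "(\<Sum>l<d. Lmat $$ (b, l) * (\<Sum>k<d. x k l * W a k)) =
              (\<Sum>l<d. \<Sum>k<d. Lmat $$ (b, l) * x k l * W a k)"
          by (simp add: sum_distrib_left mult.assoc)
        also have "\<dots> = (\<Sum>k<d. \<Sum>l<d. Lmat $$ (b, l) * x k l * W a k)" by (rule sum.swap)
        also have "\<dots> = (\<Sum>k<d. M $$ (b, k) * W a k)"
          using that by (simp add: sum_distrib_right[symmetric] x)
        also have "\<dots> = Lmat $$ (b, a) * p a" using Lp that \<open>a < i\<close> ij by simp
        also have "\<dots> = (\<Sum>l<d. if l = a then Lmat $$ (b, l) * p a else 0)"
          using \<open>a < i\<close> ij by simp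
        finally show ?thesis by (simp add: if_distrib cong: if_cong)
      qed
      then show ?thesis
        using unit_lower_triangular_inj[of d "\<lambda>a b. Lmat $$ (a, b)" d
            "\<lambda>l. \<Sum>k<d. x k l * W a k" "\<lambda>l. if l = a then p a else 0" i] L1 L0 that ij
        by auto
    qed
    note zero = this
    have "x a i = 0" if "a < i" for a
      using that
    proof (induction a rule: less_induct)
      case (less a)
      have "(\<Sum>k<d. x k i * W a k) = (\<Sum>k\<in>{a}. x k i * W a k)"
        using less ij supp[of a] by (intro sum.mono_neutral_right) (auto simp: neq_iff)
      then show ?case using zero[OF less.prems] W_diag_nonzero[OF p, of a] less.prems ij by simp
    qed
    then show "mat d d (\<lambda>(i, j). x j i) $$ (i, j) = 0" using ij by simp
  qed (use L1 L0 x in \<open>auto simp: Lmat_def\<close>)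
  then show ?thesis by blast
qed

text \<open>The last pivot is left free because the last column of L is forced. For the others,
  \<open>p j\<close> equals \<open>U $$ (j, j) * W j j\<close>, where \<open>W j j\<close> is a
  product of earlier pivots and uniqueness of L excludes a zero on the diagonal of U.\<close>

lemma L_defined_iff: "L_defined d M \<longleftrightarrow> (\<forall>j. Suc j < d \<longrightarrow> p j \<noteq> 0)"
proof
  assume def: "L_defined d M"
  then obtain L U where LU: "LU_decomp d M L U" unfolding L_defined_def by blast
  have "p j \<noteq> 0" if "Suc j < d" for j
    using that
  proof (induction j rule: less_induct)
    case (less j)
    have "p j = U $$ (j, j) * W j j"
      using LU_mult[OF LU, of j j] LU_decompD(3)[OF LU, of j] pivot[of j] less.prems by simp
    moreover have "W j j \<noteq> 0" using less diag[of j] by auto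
    ultimately show ?case using L_defined_pivot_nonzero[OF M def LU less.prems] by simp
  qed
  then show "\<forall>j. Suc j < d \<longrightarrow> p j \<noteq> 0" by blast
qed (use LU_exists LU_unique L_defined_def in blast)

lemma L_part_eq:
  assumes "\<And>j. Suc j < d \<Longrightarrow> p j \<noteq> 0"
  shows "L_part d M = Lmat"
  unfolding L_part_def by (rule the_equality) (use assms LU_exists LU_unique in blast)+

end

text \<open>
  Fraction-free column elimination, applied to all unit vectors at once: step \<open>n\<close> makes the vectors
  \<open>j > n\<close> orthogonal to row \<open>n\<close> of \<open>A\<close>.
\<close>

primrec col_elim :: "nat \<Rightarrow> (nat \<Rightarrow> nat \<Rightarrow> 'a::comm_ring_1) \<Rightarrow> nat \<Rightarrow> nat \<Rightarrow> nat \<Rightarrow> 'a" where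
  "col_elim d A 0 = (\<lambda>j k. if k = j then 1 else 0)"
| "col_elim d A (Suc n) = (\<lambda>j k.
     (\<Sum>l<d. A n l * col_elim d A n n l) * col_elim d A n j k
   - (\<Sum>l<d. A n l * col_elim d A n j l) * col_elim d A n n k)"

text \<open>Vector j is read off after exactly j steps: so far only rows before j have entered, and
  the next step would subtract from a multiple of this vector the same multiple, giving
  zero.\<close>

definition kvec :: "nat \<Rightarrow> (nat \<Rightarrow> nat \<Rightarrow> 'a::comm_ring_1) \<Rightarrow> nat \<Rightarrow> nat \<Rightarrow> 'a" where
  "kvec d A j = col_elim d A j j"

definition rowp :: "nat \<Rightarrow> (nat \<Rightarrow> nat \<Rightarrow> 'a::comm_ring_1) \<Rightarrow> nat \<Rightarrow> nat \<Rightarrow> 'a" where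
  "rowp d A i j = (\<Sum>l<d. A i l * kvec d A j l)"

text \<open>Step n changes the other vectors by multiples of vector n, which has no coordinates
  beyond n; on the coordinates still to be treated they remain multiples of unit vectors.\<close>

lemma col_elim_supp: "n \<le> j \<Longrightarrow> n \<le> k \<Longrightarrow> k \<noteq> j \<Longrightarrow> col_elim d A n j k = 0"
  by (induction n arbitrary: j) auto

lemma col_elim_kernel: "i < n \<Longrightarrow> (\<Sum>l<d. A i l * col_elim d A n j l) = 0"
proof (induction n arbitrary: j)
  case (Suc n)
  have lin: "(\<Sum>l<d. A i l * (a * x l - b * y l))
      = a * (\<Sum>l<d. A i l * x l) - b * (\<Sum>l<d. A i l * y l)" for a b x y
    by (simp add: sum_distrib_left sum_subtractf right_diff_distrib mult.left_commute)
  have "(\<Sum>l<d. A i l * col_elim d A (Suc n) j l)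
      = (\<Sum>l<d. A n l * col_elim d A n n l) * (\<Sum>l<d. A i l * col_elim d A n j l)
      - (\<Sum>l<d. A n l * col_elim d A n j l) * (\<Sum>l<d. A i l * col_elim d A n n l)"
    by (simp add: lin)
  then show ?case using Suc by (cases "i = n") auto
qed simp

lemma col_elim_diag: "n \<le> j \<Longrightarrow> col_elim d A n j j = (\<Prod>k<n. rowp d A k k)"
  by (induction n) (auto simp: col_elim_supp rowp_def kvec_def mult.commute)

lemma col_elim_cong:
  "(\<And>i l. i < n \<Longrightarrow> l < d \<Longrightarrow> A i l = B i l) \<Longrightarrow> col_elim d A n = col_elim d B n"
  by (induction n) auto

lemma kvec_supp: "j < k \<Longrightarrow> kvec d A j k = 0"
  by (simp add: kvec_def col_elim_supp)

lemma kvec_diag: "kvec d A j j = (\<Prod>k<j. rowp d A k k)"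
  by (simp add: kvec_def col_elim_diag)

lemma rowp_eq_0: "i < j \<Longrightarrow> rowp d A i j = 0"
  by (simp add: rowp_def kvec_def col_elim_kernel)

lemma kvec_cong: "(\<And>i l. i < j \<Longrightarrow> l < d \<Longrightarrow> A i l = B i l) \<Longrightarrow> kvec d A j = kvec d B j"
  unfolding kvec_def by (subst col_elim_cong[of j d A B]) auto

lemma rowp_cong:
  "(\<And>k l. k < j \<or> k = i \<Longrightarrow> l < d \<Longrightarrow> A k l = B k l) \<Longrightarrow> rowp d A i j = rowp d B i j"
  unfolding rowp_def by (subst kvec_cong[of j d A B]) auto

section \<open>Discrete valuation rings\<close>

context complete_dvr begin

lemma val_0 [simp]: "v 0 = \<infinity>"
  by (simp add: val_eq_infinity)

lemma val_finite: "x \<noteq> 0 \<Longrightarrow> \<exists>n. v x = enat n"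
  using val_eq_infinity by (metis not_infinity_eq)

lemma val_1 [simp]: "v 1 = 0"
proof -
  obtain n where "v 1 = enat n" using val_finite[of 1] by auto
  then show ?thesis using val_mult[of 1 1] by (simp add: zero_enat_def)
qed

lemma val_minus [simp]: "v (- x) = v x"
proof -
  obtain n where n: "v (- 1) = enat n" using val_finite[of "- 1"] by auto
  then have "v (- 1) = 0" using val_mult[of "- 1" "- 1"] by (simp add: zero_enat_def)
  then show ?thesis using val_mult[of "- 1" x] by simp
qed

lemma val_add_ge: "c \<le> v x \<Longrightarrow> c \<le> v y \<Longrightarrow> c \<le> v (x + y)"
  using val_add[of x y] by (meson min.boundedI order_trans)

lemma val_diff_ge: "c \<le> v x \<Longrightarrow> c \<le> v y \<Longrightarrow> c \<le> v (x - y)"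
  using val_add_ge[of c x "- y"] by simp

lemma val_sum_ge: "(\<And>i. i \<in> I \<Longrightarrow> c \<le> v (f i)) \<Longrightarrow> c \<le> v (sum f I)"
  by (induction I rule: infinite_finite_induct) (auto intro: val_add_ge)

lemma val_mult_ge: "c \<le> v x \<Longrightarrow> c \<le> v (y * x)"
  by (simp add: val_mult add_increasing)

lemma uniformizer_exists: "\<exists>t. \<forall>n. v (t ^ n) = enat n"
proof -
  obtain t where "v t = 1" using val_surj by (metis surj_def)
  then have "v (t ^ n) = enat n" for n
    by (induction n) (auto simp: val_mult one_enat_def zero_enat_def)
  then show ?thesis by blast
qed

lemma residue_field_equiv: "equiv UNIV {(x, y). 0 < v (x - y)}"
proof (rule equivI)
  show "trans {(x, y). 0 < v (x - y)}"
  proof (rule transI, clarify)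
    fix x y z assume "0 < v (x - y)" "0 < v (y - z)"
    then have "1 \<le> v (x - y + (y - z))"
      by (intro val_add_ge) (auto simp: one_eSuc ileI1)
    then show "0 < v (x - z)" by (auto simp: one_eSuc)
  qed
  show "sym {(x, y). 0 < v (x - y)}"
    by (rule symI) (metis (mono_tags, lifting) case_prodD case_prodI mem_Collect_eq minus_diff_eq val_minus)
qed (auto simp: refl_on_def)

text \<open>Representatives are chosen inside R because they will be used to translate matrix
  entries; the bijection keeps track of their number.\<close>

lemma residue_reps_exist:
  "\<exists>T. \<exists>f. bij_betw f (residue_field v) T \<and> (\<forall>x. \<exists>!c. c \<in> T \<and> 0 < v (x - c))"
proof -
  let ?R = "{(x, y). 0 < v (x - y)}"
  define f where "f C = (SOME x. x \<in> C)" for C :: "'r set"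
  have f: "f C \<in> C" if "C \<in> residue_field v" for C
    using that in_quotient_imp_non_empty[OF residue_field_equiv]
    unfolding f_def residue_field_def by (metis ex_in_conv someI_ex)
  have inj: "inj_on f (residue_field v)"
    using f quotient_disj[OF residue_field_equiv] by (intro inj_onI) (fastforce simp: residue_field_def)
  have "\<exists>!c. c \<in> f ` residue_field v \<and> 0 < v (x - c)" for x
  proof
    let ?C = "?R `` {x}"
    have C: "?C \<in> residue_field v"
      unfolding residue_field_def by (rule quotientI) simp
    show "f ?C \<in> f ` residue_field v \<and> 0 < v (x - f ?C)" using f[OF C] C by auto
    fix c assume c: "c \<in> f ` residue_field v \<and> 0 < v (x - c)"
    then obtain D where D: "D \<in> residue_field v" "c = f D" by auto
    have "c \<in> ?C" using c by auto
    then have "D = ?C"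
      using quotient_disj[OF residue_field_equiv, of D ?C] C D f[OF D(1)] by (auto simp: residue_field_def)
    then show "c = f ?C" using D by simp
  qed
  with inj show ?thesis by (auto simp: bij_betw_def)
qed

lemma card_residue_field_ge_2:
  assumes "finite (residue_field v)"
  shows "card (residue_field v) \<ge> 2"
proof -
  let ?R = "{(x, y). 0 < v (x - y)}"
  have "?R `` {0} \<noteq> ?R `` {1}"
    using eq_equiv_class_iff[OF residue_field_equiv, of 0 1] by simp
  then have "card {?R `` {0}, ?R `` {1}} = 2" by simp
  moreover have "{?R `` {0}, ?R `` {1}} \<subseteq> residue_field v"
    unfolding residue_field_def by (intro insert_subsetI empty_subsetI quotientI UNIV_I)
  ultimately show ?thesis using card_mono[OF assms] by metis
qed

end

section \<open>Haar measure on matrices\<close>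

text \<open>Countability of the values allows an arbitrary \<open>h\<close>, in particular
  comparisons and truncated differences of valuations.\<close>

lemma measurable_count_space_binary:
  fixes f :: "'a \<Rightarrow> 'b::countable" and g :: "'a \<Rightarrow> 'c::countable"
  assumes "f \<in> measurable M (count_space UNIV)" "g \<in> measurable M (count_space UNIV)"
  shows "(\<lambda>x. h (f x) (g x)) \<in> measurable M (count_space UNIV)"
  by (rule measurable_compose_countable[where f = "\<lambda>i x. h i (g x)", OF _ assms(1)])
    (rule measurable_compose[OF assms(2)], simp)

locale haar_dvr = complete_dvr v for v :: "'r::idom \<Rightarrow> enat" +
  fixes q d :: nat and \<mu> :: "'r mat measure"
  assumes residue_finite: "finite (residue_field v)"
    and residue_card: "card (residue_field v) = q"
    and haar: "haar_prob v d \<mu>"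
begin

lemma space_\<mu> [simp]: "space \<mu> = carrier_mat d d"
  and sets_\<mu>: "sets \<mu> = sigma_sets (carrier_mat d d) {S. mat_open v d S}"
  using haar by (auto simp: haar_prob_def)

sublocale prob_space \<mu>
  using haar by (simp add: haar_prob_def)

lemma q_ge_2: "q \<ge> 2"
  using card_residue_field_ge_2[OF residue_finite] residue_card by simp

text \<open>
  Polynomial functions of the entries with coefficients in the valuation ring are nonexpansive.
\<close>

definition nonexp :: "('r mat \<Rightarrow> 'r) \<Rightarrow> bool" where
  "nonexp f \<longleftrightarrow> (\<forall>A\<in>carrier_mat d d. \<forall>B\<in>carrier_mat d d. \<forall>c.
     (\<forall>i<d. \<forall>j<d. c \<le> v (B $$ (i, j) - A $$ (i, j))) \<longrightarrow> c \<le> v (f B - f A))"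

lemma nonexp_const: "nonexp (\<lambda>_. c)"
  by (simp add: nonexp_def)

lemma nonexp_entry: "i < d \<Longrightarrow> j < d \<Longrightarrow> nonexp (\<lambda>\<omega>. \<omega> $$ (i, j))"
  by (simp add: nonexp_def)

lemma nonexp_diff: "nonexp f \<Longrightarrow> nonexp g \<Longrightarrow> nonexp (\<lambda>\<omega>. f \<omega> - g \<omega>)"
proof -
  assume fg: "nonexp f" "nonexp g"
  have "f B - g B - (f A - g A) = (f B - f A) - (g B - g A)" for A B by simp
  then show ?thesis using fg unfolding nonexp_def by (metis val_diff_ge)
qed

lemma nonexp_mult: "nonexp f \<Longrightarrow> nonexp g \<Longrightarrow> nonexp (\<lambda>\<omega>. f \<omega> * g \<omega>)"
proof -
  assume fg: "nonexp f" "nonexp g"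
  have "f B * g B - f A * g A = f B * (g B - g A) + g A * (f B - f A)" for A B
    by (simp add: algebra_simps)
  then show ?thesis using fg unfolding nonexp_def by (metis val_add_ge val_mult_ge)
qed

lemma nonexp_sum: "(\<And>i. i \<in> I \<Longrightarrow> nonexp (f i)) \<Longrightarrow> nonexp (\<lambda>\<omega>. \<Sum>i\<in>I. f i \<omega>)"
  unfolding nonexp_def sum_subtractf[symmetric] by (blast intro: val_sum_ge)

text \<open>Changing all entries by elements of valuation at least n changes \<open>f\<close> by
  such an element, so the sets where \<open>v (f \<omega>)\<close> is at least n are open. Level
  sets are differences of these, and the infinite level is their intersection.\<close>

lemma measurable_val:
  assumes "nonexp f"
  shows "(\<lambda>\<omega>. v (f \<omega>)) \<in> measurable \<mu> (count_space UNIV)"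
proof -
  have ge_enat: "{\<omega>\<in>carrier_mat d d. enat n \<le> v (f \<omega>)} \<in> sets \<mu>" for n
  proof -
    have "enat n \<le> v (f B)"
      if "A \<in> carrier_mat d d" "B \<in> carrier_mat d d" "enat n \<le> v (f A)"
        "\<forall>i<d. \<forall>j<d. enat n \<le> v (B $$ (i, j) - A $$ (i, j))" for A B
      using val_add_ge[of "enat n" "f A" "f B - f A"] assms that unfolding nonexp_def by force
    then have "mat_open v d {\<omega>\<in>carrier_mat d d. enat n \<le> v (f \<omega>)}"
      unfolding mat_open_def by blast
    then show ?thesis unfolding sets_\<mu> by auto
  qed
  have ge: "{\<omega>\<in>carrier_mat d d. c \<le> v (f \<omega>)} \<in> sets \<mu>" for c
  proof (cases c)
    case infinity
    have "(\<Inter>n. {\<omega>\<in>carrier_mat d d. enat n \<le> v (f \<omega>)}) \<in> sets \<mu>" using ge_enat by blast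
    moreover have "(\<Inter>n. {\<omega>\<in>carrier_mat d d. enat n \<le> v (f \<omega>)})
        = {\<omega>\<in>carrier_mat d d. c \<le> v (f \<omega>)}"
      unfolding infinity by (auto simp: not_le[symmetric]) (metis enat_ord_simps(1) not_enat_eq Suc_n_not_le_n)
    ultimately show ?thesis by simp
  qed (use ge_enat in simp)
  have "(\<lambda>\<omega>. v (f \<omega>)) -` {c} \<inter> space \<mu> \<in> sets \<mu>" for c
  proof (cases c)
    case (enat n)
    have "(\<lambda>\<omega>. v (f \<omega>)) -` {c} \<inter> space \<mu> =
        {\<omega>\<in>carrier_mat d d. c \<le> v (f \<omega>)} - {\<omega>\<in>carrier_mat d d. eSuc c \<le> v (f \<omega>)}"
      unfolding enat by (auto simp: not_le eSuc_enat Suc_ile_eq)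
    then show ?thesis using ge by auto
  next
    case infinity
    then have "(\<lambda>\<omega>. v (f \<omega>)) -` {c} \<inter> space \<mu> = {\<omega>\<in>carrier_mat d d. c \<le> v (f \<omega>)}"
      by auto
    then show ?thesis using ge by auto
  qed
  then show ?thesis by (simp add: measurable_count_space_eq2_countable)
qed

section \<open>Translations of a single matrix entry\<close>

definition shift :: "nat \<Rightarrow> nat \<Rightarrow> 'r \<Rightarrow> 'r mat \<Rightarrow> 'r mat" where
  "shift i k c \<omega> = mat d d (\<lambda>(a, b). if a = i \<and> b = k then c else 0) + \<omega>"

text \<open>Shifts of its entries connect any two values of row i, so this says that
  \<open>f\<close> depends on the other rows only, in the form to which translation invariance of
  the measure applies.\<close>

definition row_indep :: "nat \<Rightarrow> ('r mat \<Rightarrow> 'b) \<Rightarrow> bool" where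
  "row_indep i f \<longleftrightarrow> (\<forall>\<omega>\<in>carrier_mat d d. \<forall>k<d. \<forall>c. f (shift i k c \<omega>) = f \<omega>)"

lemma shift_carrier [simp]: "\<omega> \<in> carrier_mat d d \<Longrightarrow> shift i k c \<omega> \<in> carrier_mat d d"
  by (simp add: shift_def)

lemma shift_entry:
  "\<omega> \<in> carrier_mat d d \<Longrightarrow> a < d \<Longrightarrow> b < d \<Longrightarrow>
    shift i k c \<omega> $$ (a, b) = (if a = i \<and> b = k then c else 0) + \<omega> $$ (a, b)"
  by (auto simp: shift_def)

lemma shift_shift: "\<omega> \<in> carrier_mat d d \<Longrightarrow> shift i k c (shift i k (- c) \<omega>) = \<omega>"
  by (rule eq_matI) (auto simp: shift_def)

text \<open>The invariance in \<open>haar_prob\<close> gives the measure of the image only. Its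
  measurability follows by induction over the generated sigma-algebra, since a shift is a bijection
  that maps open sets to open sets.\<close>

lemma measure_shift:
  assumes "S \<in> sets \<mu>"
  shows "shift i k c ` S \<in> sets \<mu>" "measure \<mu> (shift i k c ` S) = measure \<mu> S"
proof -
  let ?A = "mat d d (\<lambda>(a, b). if a = i \<and> b = k then c else 0)"
  have em: "emeasure \<mu> (shift i k c ` S) = emeasure \<mu> S" if "S \<in> sets \<mu>" for S c
    using haar that unfolding haar_prob_def shift_def by auto
  then show "measure \<mu> (shift i k c ` S) = measure \<mu> S" by (simp add: measure_def assms)
  show "shift i k c ` S \<in> sets \<mu>"
    using assms unfolding sets_\<mu>
  proof (induction rule: sigma_sets.induct)
    case (Basic S)
    then have S: "S \<subseteq> carrier_mat d d" by (simp add: mat_open_def)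
    have "mat_open v d (shift i k c ` S)"
      unfolding mat_open_def
    proof (intro conjI ballI)
      show "shift i k c ` S \<subseteq> carrier_mat d d" using S by auto
      fix A assume "A \<in> shift i k c ` S"
      then obtain \<omega> where \<omega>: "\<omega> \<in> S" "A = shift i k c \<omega>" by auto
      then obtain n where n: "\<forall>B\<in>carrier_mat d d.
          (\<forall>i<d. \<forall>j<d. enat n \<le> v (B $$ (i, j) - \<omega> $$ (i, j))) \<longrightarrow> B \<in> S"
        using Basic unfolding mat_open_def mem_Collect_eq by blast
      have "B \<in> shift i k c ` S" if B: "B \<in> carrier_mat d d"
        "\<forall>i<d. \<forall>j<d. enat n \<le> v (B $$ (i, j) - A $$ (i, j))" for B
      proof -
        have "shift i k (- c) B $$ (a, b) - \<omega> $$ (a, b) = B $$ (a, b) - A $$ (a, b)"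
          if "a < d" "b < d" for a b
          using that B(1) \<omega> S by (auto simp: shift_entry subset_iff)
        then have "shift i k (- c) B \<in> S" using B by (intro n[rule_format]) auto
        then show ?thesis using shift_shift[OF B(1), of i k c] by (metis imageI)
      qed
      then show "\<exists>n. \<forall>B\<in>carrier_mat d d.
          (\<forall>i<d. \<forall>j<d. enat n \<le> v (B $$ (i, j) - A $$ (i, j))) \<longrightarrow> B \<in> shift i k c ` S"
        by blast
    qed
    then show ?case by auto
  next
    case Empty
    then show ?case by (simp add: sigma_sets.Empty)
  next
    case (Compl S)
    then have S: "S \<subseteq> carrier_mat d d" using sets.sets_into_space[of S \<mu>] by (simp add: sets_\<mu>)
    have "shift i k c ` (carrier_mat d d - S) = carrier_mat d d - shift i k c ` S"
    proof (intro equalityI subsetI)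
      fix B assume "B \<in> shift i k c ` (carrier_mat d d - S)"
      then obtain \<omega> where \<omega>: "\<omega> \<in> carrier_mat d d" "\<omega> \<notin> S" "B = shift i k c \<omega>" by auto
      have "B \<noteq> shift i k c \<eta>" if "\<eta> \<in> S" for \<eta>
        using that \<omega> S shift_shift[of _ i k "- c"] by (metis add.inverse_inverse subsetD)
      then show "B \<in> carrier_mat d d - shift i k c ` S" using \<omega> by auto
    next
      fix B assume "B \<in> carrier_mat d d - shift i k c ` S"
      then show "B \<in> shift i k c ` (carrier_mat d d - S)"
        using shift_shift[of B i k c] by (metis Diff_iff image_eqI shift_carrier)
    qed
    then show ?case using Compl by (simp add: sigma_sets.Compl)
  next
    case (Union S)
    then show ?case by (simp add: image_UN sigma_sets.Union)
  qed
qed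

text \<open>
  Refining the congruence from \<open>\<pi>\<^sup>n\<close> to \<open>\<pi>\<^sup>n\<^sup>+\<^sup>1\<close> splits the event into \<open>q\<close> translates, obtained by
  adding \<open>c \<pi>\<^sup>n\<close> to the entry of row \<open>i\<close> facing a coordinate \<open>k\<close> of \<open>w\<close> of minimal valuation.
\<close>
lemma measure_row_dot_step:
  assumes i: "i < d" and k: "k < d" and meas: "Measurable.pred \<mu> P" and ind: "row_indep i P"
    and w: "\<And>l. l < d \<Longrightarrow> nonexp (\<lambda>\<omega>. w \<omega> l)" "\<And>l. l < d \<Longrightarrow> row_indep i (\<lambda>\<omega>. w \<omega> l)"
    and nz: "\<And>\<omega>. \<omega> \<in> carrier_mat d d \<Longrightarrow> P \<omega> \<Longrightarrow> w \<omega> k \<noteq> 0"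
  defines "D \<equiv> \<lambda>n. {\<omega>\<in>space \<mu>. P \<omega> \<and> enat n + v (w \<omega> k) \<le> v (\<Sum>l<d. \<omega> $$ (i, l) * w \<omega> l)}"
  shows "measure \<mu> (D n) = real q * measure \<mu> (D (Suc n))"
proof -
  obtain t where t: "\<And>n. v (t ^ n) = enat n" using uniformizer_exists by blast
  obtain T f where T: "bij_betw f (residue_field v) T" "\<And>x. \<exists>!c. c \<in> T \<and> 0 < v (x - c)"
    using residue_reps_exist by blast
  have fin: "finite T" and card: "card T = q"
    using bij_betw_finite[OF T(1)] bij_betw_same_card[OF T(1)] residue_finite residue_card by auto
  define dot where "dot \<omega> = (\<Sum>l<d. \<omega> $$ (i, l) * w \<omega> l)" for \<omega>
  have dot_shift: "dot (shift i k c \<omega>) = dot \<omega> + c * w \<omega> k" if "\<omega> \<in> carrier_mat d d" for c \<omega>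
  proof -
    have "dot (shift i k c \<omega>) = (\<Sum>l<d. \<omega> $$ (i, l) * w \<omega> l + (if l = k then c * w \<omega> k else 0))"
      unfolding dot_def
      using that i k w(2) by (intro sum.cong) (auto simp: shift_entry row_indep_def algebra_simps)
    then show ?thesis using k by (simp add: sum.distrib dot_def)
  qed
  have wk: "w (shift i k c \<omega>) k = w \<omega> k" and P: "P (shift i k c \<omega>) = P \<omega>"
    if "\<omega> \<in> carrier_mat d d" for c \<omega>
    using w(2)[OF k] ind k that by (auto simp: row_indep_def)
  have D: "D n = {\<omega>\<in>carrier_mat d d. P \<omega> \<and> enat n + v (w \<omega> k) \<le> v (dot \<omega>)}" for n
    by (simp add: D_def dot_def)
  have "D n \<in> sets \<mu>" for n
  proof -
    have "nonexp dot"
      unfolding dot_def by (intro nonexp_sum nonexp_mult nonexp_entry) (use i w in auto)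
    then have "Measurable.pred \<mu> (\<lambda>\<omega>. enat n + v (w \<omega> k) \<le> v (dot \<omega>))"
      by (intro measurable_count_space_binary[where h = "\<lambda>x y. enat n + x \<le> y"] measurable_val w k)
    then show ?thesis using meas by (simp add: D_def dot_def[symmetric] del: space_\<mu>)
  qed
  note sets = this
  have "D n = (\<Union>c\<in>T. shift i k (t ^ n * c) ` D (Suc n))"
  proof (intro equalityI subsetI)
    fix \<omega> assume \<omega>: "\<omega> \<in> D n"
    then have "v (t ^ n * w \<omega> k) \<le> v (dot \<omega>)" by (simp add: D val_mult t)
    \<comment> \<open>The residue of the quotient \<open>s\<close> is the digit to be removed from
      the entry facing coordinate \<open>k\<close>.\<close>
    then obtain s where s: "dot \<omega> = t ^ n * w \<omega> k * s" using val_dvd by (meson dvdE)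
    obtain c where c: "c \<in> T" "0 < v (s - c)" using T(2)[of s] by auto
    have "dot (shift i k (- (t ^ n * c)) \<omega>) = t ^ n * w \<omega> k * (s - c)"
      using \<omega> by (simp add: D dot_shift s algebra_simps)
    then have "v (dot (shift i k (- (t ^ n * c)) \<omega>)) = enat n + v (w \<omega> k) + v (s - c)"
      by (simp add: val_mult t)
    moreover have "enat n + v (w \<omega> k) + 1 \<le> enat n + v (w \<omega> k) + v (s - c)"
      using c(2) by (intro add_left_mono) (simp add: one_eSuc ileI1)
    moreover have "enat n + v (w \<omega> k) + 1 = enat (Suc n) + v (w \<omega> k)"
      by (cases "v (w \<omega> k)") (auto simp: one_enat_def)
    ultimately have "shift i k (- (t ^ n * c)) \<omega> \<in> D (Suc n)"
      using \<omega> by (simp add: D wk P)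
    moreover have "\<omega> = shift i k (t ^ n * c) (shift i k (- (t ^ n * c)) \<omega>)"
      using \<omega> by (simp add: D shift_shift)
    ultimately show "\<omega> \<in> (\<Union>c\<in>T. shift i k (t ^ n * c) ` D (Suc n))" using c(1) by blast
  next
    fix \<omega> assume "\<omega> \<in> (\<Union>c\<in>T. shift i k (t ^ n * c) ` D (Suc n))"
    then obtain c \<eta> where \<eta>: "\<eta> \<in> D (Suc n)" "\<omega> = shift i k (t ^ n * c) \<eta>" by auto
    have le: "enat n + v (w \<eta> k) \<le> enat (Suc n) + v (w \<eta> k)" by (intro add_right_mono) simp
    have "enat n + v (w \<eta> k) \<le> v (dot \<eta> + t ^ n * c * w \<eta> k)"
      using \<eta> by (intro val_add_ge) (auto simp: D val_mult t intro: order_trans[OF le])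
    then show "\<omega> \<in> D n" using \<eta> by (simp add: D wk P dot_shift)
  qed
  also have "measure \<mu> \<dots> = (\<Sum>c\<in>T. measure \<mu> (shift i k (t ^ n * c) ` D (Suc n)))"
  proof (rule finite_measure_finite_Union[OF fin])
    show "(\<lambda>c. shift i k (t ^ n * c) ` D (Suc n)) ` T \<subseteq> sets \<mu>"
      using measure_shift(1)[OF sets] by auto
    show "disjoint_family_on (\<lambda>c. shift i k (t ^ n * c) ` D (Suc n)) T"
      unfolding disjoint_family_on_def
    proof (intro ballI impI, rule ccontr)
      fix c c' assume c: "c \<in> T" "c' \<in> T" "c \<noteq> c'"
        and "shift i k (t ^ n * c) ` D (Suc n) \<inter> shift i k (t ^ n * c') ` D (Suc n) \<noteq> {}"
      then obtain \<omega> \<omega>' where eq: "\<omega> \<in> D (Suc n)" "\<omega>' \<in> D (Suc n)"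
        "shift i k (t ^ n * c) \<omega> = shift i k (t ^ n * c') \<omega>'" by blast
      then have carr: "\<omega> \<in> carrier_mat d d" "\<omega>' \<in> carrier_mat d d" by (auto simp: D)
      have w': "w \<omega>' k = w \<omega> k" using wk[OF carr(1)] wk[OF carr(2)] eq(3) by metis
      have "dot \<omega> + t ^ n * c * w \<omega> k = dot \<omega>' + t ^ n * c' * w \<omega> k"
        using dot_shift[OF carr(1)] dot_shift[OF carr(2)] eq(3) w' by metis
      then have "t ^ n * w \<omega> k * (c - c') = dot \<omega>' - dot \<omega>" by (simp add: algebra_simps)
      moreover have "enat (Suc n) + v (w \<omega> k) \<le> v (dot \<omega>' - dot \<omega>)"
        using eq(1,2) w' by (intro val_diff_ge) (auto simp: D)
      ultimately have "enat (Suc n) + v (w \<omega> k) \<le> v (t ^ n * w \<omega> k * (c - c'))" by simp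
      \<comment> \<open>Finiteness of the valuation of \<open>w \<omega> k\<close> allows it to be
        cancelled on both sides.\<close>
      moreover obtain m where "v (w \<omega> k) = enat m"
        using nz[OF carr(1)] eq(1) val_finite by (auto simp: D)
      ultimately have "0 < v (c - c')"
        by (cases "v (c - c')") (auto simp: val_mult t zero_enat_def)
      then have "c = c'" using T(2)[of c] c by auto
      with c show False by simp
    qed
  qed
  also have "\<dots> = real q * measure \<mu> (D (Suc n))"
    by (simp add: measure_shift(2)[OF sets] card)
  finally show ?thesis .
qed

lemma INF_val_attained:
  assumes "\<exists>k<d. w k \<noteq> (0::'r)"
  shows "\<exists>k<d. (INF l\<in>{..<d}. v (w l)) = v (w k)"
proof -
  obtain k where "k < d" using assms by blast
  then have "(INF l\<in>{..<d}. v (w l)) \<in> (\<lambda>l. v (w l)) ` {..<d}"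
    by (intro wellorder_InfI[of "v (w k)"]) auto
  then show ?thesis by auto
qed

text \<open>The refinement step needs a fixed coordinate of minimal valuation, so the event is split
  according to the first such coordinate \<open>k \<omega>\<close>. On each piece the measure is
  divided by q at every step; for n = 0 the condition is void because the content bounds the product
  from below.\<close>

lemma measure_row_dot:
  assumes i: "i < d" and meas: "Measurable.pred \<mu> P" and ind: "row_indep i P"
    and w: "\<And>l. l < d \<Longrightarrow> nonexp (\<lambda>\<omega>. w \<omega> l)" "\<And>l. l < d \<Longrightarrow> row_indep i (\<lambda>\<omega>. w \<omega> l)"
    and nz: "\<And>\<omega>. \<omega> \<in> carrier_mat d d \<Longrightarrow> P \<omega> \<Longrightarrow> \<exists>l<d. w \<omega> l \<noteq> 0"
  shows "measure \<mu> {\<omega>\<in>space \<mu>. P \<omega> \<and>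
      enat n + (INF l\<in>{..<d}. v (w \<omega> l)) \<le> v (\<Sum>l<d. \<omega> $$ (i, l) * w \<omega> l)}
    = measure \<mu> {\<omega>\<in>space \<mu>. P \<omega>} / real q ^ n"
proof -
  define dot where "dot \<omega> = (\<Sum>l<d. \<omega> $$ (i, l) * w \<omega> l)" for \<omega>
  define a where "a \<omega> = (INF l\<in>{..<d}. v (w \<omega> l))" for \<omega>
  define k where "k \<omega> = (LEAST k. k < d \<and> a \<omega> = v (w \<omega> k))" for \<omega>
  have k: "k \<omega> < d" "a \<omega> = v (w \<omega> (k \<omega>))" if "\<omega> \<in> carrier_mat d d" "P \<omega>" for \<omega>
    using LeastI_ex[OF INF_val_attained[OF nz[OF that]]] unfolding k_def a_def by auto
  have a_meas: "a \<in> measurable \<mu> (count_space UNIV)"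
    unfolding a_def by (intro measurable_SUP measurable_INF measurable_val w) auto
  have pred_k: "Measurable.pred \<mu> (\<lambda>\<omega>. k \<omega> = m)" for m
  proof -
    have "Measurable.pred \<mu> (\<lambda>\<omega>. l < d \<and> a \<omega> = v (w \<omega> l))" for l
    proof (cases "l < d")
      case True
      have "Measurable.pred \<mu> (\<lambda>\<omega>. a \<omega> = v (w \<omega> l))"
        by (intro measurable_count_space_binary[where h = "(=)"] a_meas measurable_val w True)
      then show ?thesis using True by simp
    qed simp
    then have "k \<in> measurable \<mu> (count_space UNIV)"
      unfolding k_def by (rule measurable_Least)
    then show ?thesis by (rule measurable_compose[where g = "\<lambda>l. l = m"]) simp
  qed
  have indk: "row_indep i k"
  proof -
    have "(\<forall>l<d. w (shift i m c \<omega>) l = w \<omega> l)" if "\<omega> \<in> carrier_mat d d" "m < d" for m c \<omega>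
      using w(2) that by (auto simp: row_indep_def)
    then have "k (shift i m c \<omega>) = k \<omega>" if "\<omega> \<in> carrier_mat d d" "m < d" for m c \<omega>
      using that unfolding k_def a_def by (simp cong: INF_cong_simp conj_cong)
    then show ?thesis by (auto simp: row_indep_def)
  qed
  define D where
    "D m n = {\<omega>\<in>space \<mu>. (P \<omega> \<and> k \<omega> = m) \<and> enat n + v (w \<omega> m) \<le> v (dot \<omega>)}" for m n
  have nonexp_dot: "nonexp dot"
    unfolding dot_def by (intro nonexp_sum nonexp_mult nonexp_entry) (use i w in auto)
  have D_sets: "D m n \<in> sets \<mu>" if "m < d" for m n
  proof -
    have "Measurable.pred \<mu> (\<lambda>\<omega>. enat n + v (w \<omega> m) \<le> v (dot \<omega>))"
      by (intro measurable_count_space_binary[where h = "\<lambda>x y. enat n + x \<le> y"]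
          measurable_val w that nonexp_dot)
    then show ?thesis using meas pred_k by (simp add: D_def del: space_\<mu>)
  qed
  have D_step: "measure \<mu> (D m n) = real q * measure \<mu> (D m (Suc n))" if m: "m < d" for m n
    unfolding D_def dot_def
  proof (rule measure_row_dot_step[OF i m])
    show "Measurable.pred \<mu> (\<lambda>\<omega>. P \<omega> \<and> k \<omega> = m)" using meas pred_k by simp
    show "row_indep i (\<lambda>\<omega>. P \<omega> \<and> k \<omega> = m)" using ind indk by (simp add: row_indep_def)
    fix \<omega> assume \<omega>: "\<omega> \<in> carrier_mat d d" "P \<omega> \<and> k \<omega> = m"
    obtain l where l: "l < d" "w \<omega> l \<noteq> 0" using nz[of \<omega>] \<omega> by auto
    have "a \<omega> \<le> v (w \<omega> l)" unfolding a_def by (rule INF_lower) (use l in simp)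
    then have "v (w \<omega> m) \<le> v (w \<omega> l)" using k[of \<omega>] \<omega> by auto
    then show "w \<omega> m \<noteq> 0" using l(2) by (auto simp: val_eq_infinity)
  qed (use w in auto)
  have D_pow: "measure \<mu> (D m n) = measure \<mu> (D m 0) / real q ^ n" if "m < d" for m
  proof (induction n)
    case (Suc n)
    then show ?case using D_step[OF that, of n] q_ge_2 by (simp add: field_simps)
  qed simp
  have a_eq: "a \<omega> = v (w \<omega> m)" if "\<omega> \<in> carrier_mat d d" "P \<omega>" "k \<omega> = m" for \<omega> m
    using k that by auto
  have total: "measure \<mu> {\<omega>\<in>space \<mu>. P \<omega> \<and> enat n + a \<omega> \<le> v (dot \<omega>)}
      = (\<Sum>m<d. measure \<mu> (D m n))" for n
  proof -
    have "{\<omega>\<in>space \<mu>. P \<omega> \<and> enat n + a \<omega> \<le> v (dot \<omega>)} = (\<Union>m<d. D m n)"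
      using k by (auto simp: D_def a_eq)
    also have "measure \<mu> \<dots> = (\<Sum>m<d. measure \<mu> (D m n))"
      by (rule finite_measure_finite_Union)
        (use D_sets in \<open>auto simp: disjoint_family_on_def D_def\<close>)
    finally show ?thesis .
  qed
  have "{\<omega>\<in>space \<mu>. P \<omega> \<and> enat 0 + a \<omega> \<le> v (dot \<omega>)} = {\<omega>\<in>space \<mu>. P \<omega>}"
  proof -
    have "a \<omega> \<le> v (dot \<omega>)" for \<omega>
      unfolding dot_def a_def by (intro val_sum_ge val_mult_ge INF_lower) auto
    then show ?thesis by (auto simp: zero_enat_def[symmetric])
  qed
  then have "(\<Sum>m<d. measure \<mu> (D m 0)) = measure \<mu> {\<omega>\<in>space \<mu>. P \<omega>}" using total[of 0] by simp
  then have "(\<Sum>m<d. measure \<mu> (D m n)) = measure \<mu> {\<omega>\<in>space \<mu>. P \<omega>} / real q ^ n"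
    by (simp add: D_pow sum_divide_distrib[symmetric])
  then show ?thesis using total[of n] by (simp add: a_def dot_def)
qed

end

section \<open>The distribution of the valuation of L\<close>

lemma enat_less_diff_iff:
  fixes x c :: enat
  shows "c \<noteq> \<infinity> \<Longrightarrow> enat t < x - c \<longleftrightarrow> enat (Suc t) + c \<le> x"
  by (cases x; cases c) auto

lemma enat_diff_mono: "a \<le> b \<Longrightarrow> (x::enat) - b \<le> x - a"
  by (cases x; cases a; cases b) auto

lemma Sup_enat_attained:
  fixes f :: "'a \<Rightarrow> enat"
  assumes "finite I" "I \<noteq> {}"
  shows "\<exists>i\<in>I. f i = (SUP i\<in>I. f i)"
proof -
  have "(SUP i\<in>I. f i) = Max (f ` I)" using assms by (simp add: Max_Sup)
  then have "(SUP i\<in>I. f i) \<in> f ` I" using Max_in[of "f ` I"] assms by simp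
  then show ?thesis by auto
qed

text \<open>Tail summation. A summable majorant \<open>g\<close> of the tails suffices, because the
  tails are known exactly for \<open>Xmax\<close> but only bounded for \<open>H\<close> and
  \<open>Z\<close>.\<close>

lemma (in prob_space) integral_enat:
  fixes f :: "'a \<Rightarrow> enat" and g :: "nat \<Rightarrow> real"
  assumes f: "f \<in> measurable M (count_space UNIV)" and fin: "AE x in M. f x \<noteq> \<infinity>"
    and le: "\<And>t. prob {x\<in>space M. enat t < f x} \<le> g t" and g: "summable g"
  shows "integrable M (\<lambda>x. real (the_enat (f x)))"
    and "(\<integral>x. real (the_enat (f x)) \<partial>M) = (\<Sum>t. prob {x\<in>space M. enat t < f x})"
    and "(\<integral>x. real (the_enat (f x)) \<partial>M) \<le> (\<Sum>t. g t)"
proof -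
  have meas: "(\<lambda>x. real (the_enat (f x))) \<in> borel_measurable M"
    by (rule measurable_compose[OF f]) simp
  have summ: "summable (\<lambda>t. prob {x\<in>space M. enat t < f x})"
    by (rule summable_comparison_test'[OF g]) (use le in auto)
  have "(\<integral>\<^sup>+x. ennreal (real (the_enat (f x))) \<partial>M) = (\<integral>\<^sup>+x. ennreal_of_enat (f x) \<partial>M)"
    by (rule nn_integral_cong_AE, use fin in eventually_elim)
      (auto simp: ennreal_of_nat_eq_real_of_nat)
  also have "\<dots> = (\<Sum>t. emeasure M {x\<in>space M. enat t < f x})"
    by (rule nn_integral_enat_function[OF f])
  also have "\<dots> = ennreal (\<Sum>t. prob {x\<in>space M. enat t < f x})"
    unfolding emeasure_eq_measure by (rule suminf_ennreal2[OF _ summ]) simp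
  finally have *: "(\<integral>\<^sup>+x. ennreal (real (the_enat (f x))) \<partial>M)
    = ennreal (\<Sum>t. prob {x\<in>space M. enat t < f x})" .
  show "integrable M (\<lambda>x. real (the_enat (f x)))"
    by (rule integrableI_nn_integral_finite[OF meas _ *]) simp
  show eq: "(\<integral>x. real (the_enat (f x)) \<partial>M) = (\<Sum>t. prob {x\<in>space M. enat t < f x})"
    by (subst integral_eq_nn_integral[OF meas]) (auto simp: * suminf_nonneg[OF summ])
  show "(\<integral>x. real (the_enat (f x)) \<partial>M) \<le> (\<Sum>t. g t)"
    unfolding eq by (rule suminf_le[OF le summ g])
qed

context haar_dvr begin

text \<open>
  \<open>W j\<close> is orthogonal to the rows before row \<open>j\<close> and determined by them, \<open>R i j\<close> is its product with
  row \<open>i\<close>, so that \<open>L\<^sub>i\<^sub>j = R i j / R j j\<close>, and \<open>cont j\<close> is the valuation of its content.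
  Rows and columns are numbered from \<open>0\<close>; the last column of \<open>L\<close> is trivial, whence \<open>j < d - 1\<close>.
\<close>

definition W :: "nat \<Rightarrow> 'r mat \<Rightarrow> nat \<Rightarrow> 'r" where
  "W j \<omega> = kvec d (\<lambda>a b. \<omega> $$ (a, b)) j"

definition R :: "nat \<Rightarrow> nat \<Rightarrow> 'r mat \<Rightarrow> 'r" where
  "R i j \<omega> = rowp d (\<lambda>a b. \<omega> $$ (a, b)) i j"

definition cont :: "nat \<Rightarrow> 'r mat \<Rightarrow> enat" where
  "cont j \<omega> = (INF l\<in>{..<d}. v (W j \<omega> l))"

definition X :: "nat \<Rightarrow> 'r mat \<Rightarrow> enat" where
  "X j \<omega> = v (R j j \<omega>) - cont j \<omega>"

definition Xmax :: "'r mat \<Rightarrow> enat" where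
  "Xmax \<omega> = (SUP j\<in>{..<d - 1}. X j \<omega>)"

definition good :: "'r mat \<Rightarrow> bool" where
  "good \<omega> \<longleftrightarrow> (\<forall>j<d - 1. R j j \<omega> \<noteq> 0)"

text \<open>
  Differences are taken in \<open>enat\<close>, hence truncated at \<open>0\<close>, where the zero and unit entries of \<open>L\<close>
  would enter; moreover \<open>n - \<infinity> = 0\<close>.
\<close>

definition H :: "'r mat \<Rightarrow> enat" where
  "H \<omega> = (SUP (i, j)\<in>{..<d} \<times> {..<d - 1}. v (R j j \<omega>) - v (R i j \<omega>))"

lemma R_eq: "R i j \<omega> = (\<Sum>l<d. \<omega> $$ (i, l) * W j \<omega> l)"
  by (simp add: R_def W_def rowp_def)

lemma nonexp_W: "j \<le> d \<Longrightarrow> nonexp (\<lambda>\<omega>. W j \<omega> l)"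
proof -
  have "n \<le> d \<Longrightarrow> nonexp (\<lambda>\<omega>. col_elim d (\<lambda>a b. \<omega> $$ (a, b)) n j l)" for n j l
  proof (induction n arbitrary: j l)
    case (Suc n)
    then show ?case
      by (auto intro!: nonexp_diff nonexp_mult nonexp_sum nonexp_entry)
  qed (auto intro: nonexp_const)
  then show "j \<le> d \<Longrightarrow> nonexp (\<lambda>\<omega>. W j \<omega> l)" by (simp add: W_def kvec_def)
qed

lemma nonexp_R: "i < d \<Longrightarrow> j \<le> d \<Longrightarrow> nonexp (R i j)"
  unfolding R_eq by (intro nonexp_sum nonexp_mult nonexp_entry nonexp_W) auto

lemma row_indep_W: "j \<le> i \<Longrightarrow> j \<le> d \<Longrightarrow> row_indep i (W j)"
  unfolding row_indep_def W_def by (auto intro!: kvec_cong simp: shift_entry)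

lemma row_indep_R: "j \<le> i \<Longrightarrow> a \<noteq> i \<Longrightarrow> a < d \<Longrightarrow> j \<le> d \<Longrightarrow> row_indep i (R a j)"
  unfolding row_indep_def R_def by (auto intro!: rowp_cong simp: shift_entry)

lemma row_indep_cont: "j \<le> i \<Longrightarrow> j \<le> d \<Longrightarrow> row_indep i (cont j)"
  using row_indep_W[of j i] by (simp add: row_indep_def cont_def)

lemma row_indep_X: "j < i \<Longrightarrow> j < d \<Longrightarrow> row_indep i (X j)"
  using row_indep_R[of j i j] row_indep_cont[of j i] by (simp add: row_indep_def X_def)

lemma measurable_vR: "i < d \<Longrightarrow> j \<le> d \<Longrightarrow> (\<lambda>\<omega>. v (R i j \<omega>)) \<in> measurable \<mu> (count_space UNIV)"
  by (intro measurable_val nonexp_R)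

lemma measurable_cont: "j \<le> d \<Longrightarrow> cont j \<in> measurable \<mu> (count_space UNIV)"
  unfolding cont_def by (intro measurable_INF measurable_val nonexp_W) auto

lemma measurable_X: "j < d \<Longrightarrow> X j \<in> measurable \<mu> (count_space UNIV)"
  unfolding X_def
  by (intro measurable_count_space_binary[where h = "(-)"] measurable_vR measurable_cont) auto

lemma measurable_Xmax: "Xmax \<in> measurable \<mu> (count_space UNIV)"
  unfolding Xmax_def by (intro measurable_SUP measurable_X) auto

lemma measurable_H: "H \<in> measurable \<mu> (count_space UNIV)"
  unfolding H_def
  by (intro measurable_SUP)
    (auto intro!: measurable_count_space_binary[where h = "(-)"] measurable_vR)

lemma W_nonzero:
  assumes "j < d" "\<And>k. k < j \<Longrightarrow> R k k \<omega> \<noteq> 0"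
  shows "W j \<omega> j \<noteq> 0"
  using assms by (simp add: W_def kvec_diag R_def)

lemma cont_finite:
  assumes "j < d" "\<And>k. k < j \<Longrightarrow> R k k \<omega> \<noteq> 0"
  shows "cont j \<omega> \<noteq> \<infinity>"
proof -
  have "cont j \<omega> \<le> v (W j \<omega> j)" unfolding cont_def by (rule INF_lower) (use assms in simp)
  then show ?thesis using W_nonzero[OF assms] val_finite[of "W j \<omega> j"] by (metis infinity_ileE)
qed

lemma cont_le: "cont j \<omega> \<le> v (R i j \<omega>)"
  unfolding R_eq cont_def by (intro val_sum_ge val_mult_ge INF_lower)

text \<open>In \<open>enat\<close>, infinity minus anything is infinity, even infinity minus itself.
  A zero pivot is thereby recorded as an infinite value.\<close>

lemma X_infinite: "R j j \<omega> = 0 \<Longrightarrow> X j \<omega> = \<infinity>"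
  by (simp add: X_def)

text \<open>The vector \<open>W j\<close> does not involve row i once j \<le> i. The case i = j
  governs \<open>X j\<close>, and the last row governs the loss \<open>Z\<close>. Nonzero pivots
  before j make \<open>W j\<close> nonzero through its diagonal entry.\<close>

lemma measure_R:
  assumes i: "i < d" and j: "j \<le> i" and meas: "Measurable.pred \<mu> P" and ind: "row_indep i P"
    and nz: "\<And>\<omega> k. \<omega> \<in> carrier_mat d d \<Longrightarrow> P \<omega> \<Longrightarrow> k < j \<Longrightarrow> R k k \<omega> \<noteq> 0"
  shows "prob {\<omega>\<in>space \<mu>. P \<omega> \<and> enat n + cont j \<omega> \<le> v (R i j \<omega>)}
    = prob {\<omega>\<in>space \<mu>. P \<omega>} / real q ^ n"
  unfolding R_eq cont_def
proof (rule measure_row_dot[OF i meas ind])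
  show "row_indep i (\<lambda>\<omega>. W j \<omega> l)" for l
    using row_indep_W[of j i] i j by (simp add: row_indep_def)
  show "\<exists>l<d. W j \<omega> l \<noteq> 0" if "\<omega> \<in> carrier_mat d d" "P \<omega>" for \<omega>
    using W_nonzero[of j \<omega>] nz[OF that] i j by (intro exI[of _ j]) auto
  show "nonexp (\<lambda>\<omega>. W j \<omega> l)" for l by (rule nonexp_W) (use i j in simp)
qed

lemma pred_R_ge: "i < d \<Longrightarrow> j \<le> d \<Longrightarrow> Measurable.pred \<mu> (\<lambda>\<omega>. enat n + cont j \<omega> \<le> v (R i j \<omega>))"
  by (intro measurable_count_space_binary[where h = "\<lambda>x y. enat n + x \<le> y"]
      measurable_vR measurable_cont)

lemma pred_X_le_all:
  assumes "j \<le> d"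
  shows "Measurable.pred \<mu> (\<lambda>\<omega>. \<forall>i<j. k \<le> i \<longrightarrow> X i \<omega> \<le> c)"
proof -
  have eq: "(\<lambda>\<omega>. \<forall>i<j. k \<le> i \<longrightarrow> X i \<omega> \<le> c) = (\<lambda>\<omega>. (SUP i\<in>{k..<j}. X i \<omega>) \<le> c)"
    unfolding SUP_le_iff fun_eq_iff by (metis atLeastLessThan_iff)
  have "(\<lambda>\<omega>. SUP i\<in>{k..<j}. X i \<omega>) \<in> measurable \<mu> (count_space UNIV)"
    using assms by (intro measurable_SUP measurable_X) auto
  then show ?thesis
    unfolding eq by (rule measurable_compose[where g = "\<lambda>x. x \<le> c"]) simp
qed

text \<open>
  Conditionally on the preceding rows, row \<open>j\<close> makes \<open>X j\<close> geometric, so the \<open>X j\<close> with \<open>k \<le> j\<close>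
  are independent geometric variables, also independent of an event about the first \<open>k\<close> rows.
\<close>
lemma measure_X_le_all:
  assumes meas: "Measurable.pred \<mu> P" and ind: "\<And>i. k \<le> i \<Longrightarrow> i < d \<Longrightarrow> row_indep i P"
    and nz: "\<And>\<omega> i. \<omega> \<in> carrier_mat d d \<Longrightarrow> P \<omega> \<Longrightarrow> i < k \<Longrightarrow> R i i \<omega> \<noteq> 0"
    and "k \<le> j" "j \<le> d"
  shows "prob {\<omega>\<in>space \<mu>. P \<omega> \<and> (\<forall>i<j. k \<le> i \<longrightarrow> X i \<omega> \<le> enat t)}
    = prob {\<omega>\<in>space \<mu>. P \<omega>} * (1 - 1 / real q ^ Suc t) ^ (j - k)"
  using \<open>k \<le> j\<close> \<open>j \<le> d\<close>
proof (induction j rule: dec_induct)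
  case base
  have "(\<forall>i<k. k \<le> i \<longrightarrow> X i \<omega> \<le> enat t)" for \<omega> by auto
  then show ?case by simp
next
  case (step j)
  define C where "C \<omega> \<longleftrightarrow> P \<omega> \<and> (\<forall>i<j. k \<le> i \<longrightarrow> X i \<omega> \<le> enat t)" for \<omega>
  have C: "Measurable.pred \<mu> C"
    unfolding C_def
    by (rule measurable_count_space_binary[where h = "(\<and>)", OF meas pred_X_le_all]) (use step in simp)
  \<comment> \<open>A finite bound on \<open>X i\<close> excludes a zero pivot, so the vectors
    needed for row \<open>j\<close> are nonzero on \<open>C\<close>.\<close>
  have nzC: "R i i \<omega> \<noteq> 0" if "\<omega> \<in> carrier_mat d d" "C \<omega>" "i < j" for \<omega> i
    using that nz[of \<omega> i] X_infinite[of i \<omega>] by (cases "i < k") (auto simp: C_def)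
  have "row_indep j C"
    using ind[of j] row_indep_X[of _ j] step unfolding C_def row_indep_def
    by (auto simp: less_le_trans)
  then have ge: "prob {\<omega>\<in>space \<mu>. C \<omega> \<and> enat (Suc t) + cont j \<omega> \<le> v (R j j \<omega>)}
      = prob {\<omega>\<in>space \<mu>. C \<omega>} / real q ^ Suc t"
    by (intro measure_R C nzC) (use step in auto)
  have X_iff: "X j \<omega> \<le> enat t \<longleftrightarrow> \<not> enat (Suc t) + cont j \<omega> \<le> v (R j j \<omega>)"
    if "\<omega> \<in> carrier_mat d d" "C \<omega>" for \<omega>
    using enat_less_diff_iff[OF cont_finite, of j \<omega> t] nzC[OF that] step
    by (simp add: X_def not_less[symmetric])
  have "{\<omega>\<in>space \<mu>. P \<omega> \<and> (\<forall>i<Suc j. k \<le> i \<longrightarrow> X i \<omega> \<le> enat t)}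
      = {\<omega>\<in>space \<mu>. C \<omega>} - {\<omega>\<in>space \<mu>. C \<omega> \<and> enat (Suc t) + cont j \<omega> \<le> v (R j j \<omega>)}"
    using X_iff step(1) by (auto simp: C_def less_Suc_eq)
  also have "prob \<dots> = prob {\<omega>\<in>space \<mu>. C \<omega>} * (1 - 1 / real q ^ Suc t)"
    by (subst finite_measure_Diff)
      (use C pred_R_ge[of j j "Suc t"] step in \<open>auto simp: ge right_diff_distrib simp del: space_\<mu>\<close>)
  also have "prob {\<omega>\<in>space \<mu>. C \<omega>} = prob {\<omega>\<in>space \<mu>. P \<omega>} * (1 - 1 / real q ^ Suc t) ^ (j - k)"
    using step by (simp add: C_def)
  finally show ?case using step by (simp add: Suc_diff_le mult_ac)
qed

lemma tail_bounds: "0 < 1 / real q ^ Suc t" "1 / real q ^ Suc t < 1"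
  using q_ge_2 one_less_power[of "real q" "Suc t"] by (auto simp: divide_simps)

lemma measure_Xmax: "prob {\<omega>\<in>space \<mu>. enat t < Xmax \<omega>} = 1 - (1 - 1 / real q ^ Suc t) ^ (d - 1)"
proof -
  \<comment> \<open>The conjuncts \<open>True\<close> and \<open>0 \<le> i\<close> match
    \<open>measure_X_le_all\<close> with the trivial event and k = 0.\<close>
  have "enat t < Xmax \<omega> \<longleftrightarrow> \<not> (True \<and> (\<forall>i<d - 1. 0 \<le> i \<longrightarrow> X i \<omega> \<le> enat t))" for \<omega>
    unfolding Xmax_def less_SUP_iff by (metis lessThan_iff not_le zero_le)
  then have "{\<omega>\<in>space \<mu>. enat t < Xmax \<omega>}
      = space \<mu> - {\<omega>\<in>space \<mu>. True \<and> (\<forall>i<d - 1. 0 \<le> i \<longrightarrow> X i \<omega> \<le> enat t)}"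
    by blast
  also have "prob \<dots> = 1 - prob {\<omega>\<in>space \<mu>. True \<and> (\<forall>i<d - 1. 0 \<le> i \<longrightarrow> X i \<omega> \<le> enat t)}"
    by (intro prob_compl predE measurable_count_space_binary[where h = "(\<and>)"] pred_X_le_all) auto
  also have "\<dots> = 1 - (1 - 1 / real q ^ Suc t) ^ (d - 1)"
    by (subst measure_X_le_all) (auto simp: row_indep_def prob_space simp del: space_\<mu>)
  finally show ?thesis .
qed

lemma Xmax_infinite: "\<not> good \<omega> \<Longrightarrow> Xmax \<omega> = \<infinity>"
proof -
  assume "\<not> good \<omega>"
  then obtain j where j: "j < d - 1" "R j j \<omega> = 0" by (auto simp: good_def)
  then have "X j \<omega> \<le> Xmax \<omega>" unfolding Xmax_def by (intro SUP_upper) auto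
  then show ?thesis using X_infinite[OF j(2)] by simp
qed

lemma Xmax_finite: "good \<omega> \<Longrightarrow> Xmax \<omega> \<noteq> \<infinity>"
proof (cases "d - 1 = 0")
  case False
  assume good: "good \<omega>"
  have "{..<d - 1} \<noteq> {}" using False by (simp add: lessThan_empty_iff)
  then obtain j where j: "j < d - 1" "X j \<omega> = Xmax \<omega>"
    using Sup_enat_attained[of "{..<d - 1}" "\<lambda>j. X j \<omega>"] unfolding Xmax_def by blast
  have "R j j \<omega> \<noteq> 0" using good j by (auto simp: good_def)
  then obtain a where a: "v (R j j \<omega>) = enat a" using val_finite by blast
  then show ?thesis unfolding j(2)[symmetric] by (cases "cont j \<omega>") (auto simp: X_def)
qed (simp add: Xmax_def bot_enat_def)

lemma pred_good: "Measurable.pred \<mu> good"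
proof -
  have "good \<omega> \<longleftrightarrow> Xmax \<omega> \<noteq> \<infinity>" for \<omega>
    using Xmax_infinite Xmax_finite by metis
  then have "good = (\<lambda>\<omega>. Xmax \<omega> \<noteq> \<infinity>)" by (rule ext)
  then show ?thesis
    using measurable_compose[OF measurable_Xmax, of "\<lambda>x. x \<noteq> \<infinity>" "count_space UNIV"] by simp
qed

text \<open>A zero pivot makes \<open>Xmax\<close> infinite, while the tails of \<open>Xmax\<close>
  tend to 0.\<close>

lemma AE_good: "AE \<omega> in \<mu>. good \<omega>"
proof -
  have sets: "{\<omega>\<in>space \<mu>. good \<omega>} \<in> sets \<mu>" using pred_good by (simp del: space_\<mu>)
  have lim: "(\<lambda>t. (1 - 1 / real q ^ Suc t) ^ (d - 1)) \<longlonglongrightarrow> (1 - 0) ^ (d - 1)"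
  proof (intro tendsto_intros)
    have "(\<lambda>t. (1 / real q) ^ t) \<longlonglongrightarrow> 0"
      using q_ge_2 by (intro LIMSEQ_power_zero) auto
    from LIMSEQ_Suc[OF this] show "(\<lambda>t. 1 / real q ^ Suc t) \<longlonglongrightarrow> 0" by (simp only: power_one_over)
  qed
  have "(1 - 1 / real q ^ Suc t) ^ (d - 1) \<le> prob {\<omega>\<in>space \<mu>. good \<omega>}" for t
  proof -
    have neg: "prob {\<omega>\<in>space \<mu>. \<not> enat t < Xmax \<omega>} = 1 - prob {\<omega>\<in>space \<mu>. enat t < Xmax \<omega>}"
      by (rule prob_neg) (use measurable_compose[OF measurable_Xmax, of "\<lambda>x. enat t < x"]
        in \<open>simp del: space_\<mu>\<close>)
    have "prob {\<omega>\<in>space \<mu>. \<not> enat t < Xmax \<omega>} \<le> prob {\<omega>\<in>space \<mu>. good \<omega>}"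
      by (rule finite_measure_mono[OF _ sets]) (use Xmax_infinite in force)
    then show ?thesis unfolding neg measure_Xmax by linarith
  qed
  then have "1 \<le> prob {\<omega>\<in>space \<mu>. good \<omega>}"
    using LIMSEQ_le_const2[OF lim] by auto
  then have "prob {\<omega>\<in>space \<mu>. good \<omega>} = 1" using prob_le_1 by (simp add: order_antisym)
  then show ?thesis using AE_prob_1[of "{\<omega>\<in>space \<mu>. good \<omega>}"] by (auto elim: eventually_mono)
qed

text \<open>The content of \<open>W j\<close> bounds every \<open>v (R i j \<omega>)\<close> from
  below, so no entry of column j contributes more than \<open>X j\<close>.\<close>

lemma H_le_Xmax: "H \<omega> \<le> Xmax \<omega>"
  unfolding H_def
proof (intro SUP_least, clarify)
  fix i j assume "j < d - 1"
  have "v (R j j \<omega>) - v (R i j \<omega>) \<le> X j \<omega>"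
    unfolding X_def by (rule enat_diff_mono[OF cont_le])
  also have "\<dots> \<le> Xmax \<omega>"
    unfolding Xmax_def by (rule SUP_upper) (use \<open>j < d - 1\<close> in simp)
  finally show "v (R j j \<omega>) - v (R i j \<omega>) \<le> Xmax \<omega>" .
qed

section \<open>Expressing the random variable through the elimination vectors\<close>

lemma LU_kernel_W:
  assumes "\<omega> \<in> carrier_mat d d"
  shows "LU_kernel d (map_mat to_fract \<omega>) (\<lambda>j k. to_fract (W j \<omega> k)) (\<lambda>j. to_fract (R j j \<omega>))"
proof
  have prod: "to_fract (prod f S) = (\<Prod>x\<in>S. to_fract (f x))" for f :: "nat \<Rightarrow> 'r" and S
    by (induction S rule: infinite_finite_induct) auto
  have row: "(\<Sum>k<d. map_mat to_fract \<omega> $$ (i, k) * to_fract (W j \<omega> k)) = to_fract (R i j \<omega>)"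
    if "i < d" for i j
    using assms that by (simp add: R_eq)
  show "map_mat to_fract \<omega> \<in> carrier_mat d d" using assms by simp
  show "to_fract (W j \<omega> k) = 0" if "j < k" for j k using that by (simp add: W_def kvec_supp)
  show "to_fract (W j \<omega> j) = (\<Prod>k<j. to_fract (R k k \<omega>))" for j
    by (simp add: W_def kvec_diag prod R_def)
  show "(\<Sum>k<d. map_mat to_fract \<omega> $$ (i, k) * to_fract (W j \<omega> k)) = 0" if "i < j" "j < d" for i j
    using row[of i j] that by (simp add: R_def rowp_eq_0)
  show "(\<Sum>k<d. map_mat to_fract \<omega> $$ (j, k) * to_fract (W j \<omega> k)) = to_fract (R j j \<omega>)"
    if "j < d" for j
    using row that by simp
qed

lemma L_defined_iff_good:
  assumes "\<omega> \<in> carrier_mat d d"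
  shows "L_defined d (map_mat to_fract \<omega>) \<longleftrightarrow> good \<omega>"
  unfolding LU_kernel.L_defined_iff[OF LU_kernel_W[OF assms]] good_def by auto

text \<open>The entries of L outside the last column are quotients of the \<open>R i j\<close>, so
  up to truncation at 0 both sides compare the same differences. The truncation is harmless because
  L has an entry 1.\<close>

lemma V_L_eq:
  assumes d: "d \<ge> 1" and \<omega>: "\<omega> \<in> carrier_mat d d"
  shows "V_L v d \<omega> = (if good \<omega> then real (the_enat (H \<omega>)) else 0)"
proof (cases "good \<omega>")
  case True
  interpret LU_kernel d "map_mat to_fract \<omega>" "\<lambda>j k. to_fract (W j \<omega> k)" "\<lambda>j. to_fract (R j j \<omega>)"
    by (rule LU_kernel_W[OF \<omega>])
  define S where "S = {valK v (L_part d (map_mat to_fract \<omega>) $$ (i, j)) | i j. i < d \<and> j < d}"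
  have L: "L_part d (map_mat to_fract \<omega>) = Lmat"
    by (rule L_part_eq) (use True in \<open>auto simp: good_def\<close>)
  obtain h where h: "H \<omega> = enat h"
    using H_le_Xmax[of \<omega>] Xmax_finite[OF True] by (cases "H \<omega>") auto
  have val01: "valK v 0 = \<infinity>" "valK v 1 = 0"
    using valK_Fract[of 1 0] valK_Fract[of 1 1]
    by (auto simp: Zero_fract_def[symmetric] One_fract_def[symmetric])
  have val: "valK v (Lmat $$ (i, j)) = ereal_of_enat (v (R i j \<omega>)) - ereal_of_enat (v (R j j \<omega>))"
    and p: "R j j \<omega> \<noteq> 0" if "i < d" "j < d - 1" for i j
  proof -
    show p: "R j j \<omega> \<noteq> 0" using True that by (simp add: good_def)
    have "(\<Sum>k<d. map_mat to_fract \<omega> $$ (i, k) * to_fract (W j \<omega> k)) = to_fract (R i j \<omega>)"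
      using that \<omega> by (simp add: R_eq)
    then have "Lmat $$ (i, j) = Fraction_Field.Fract (R i j \<omega>) (R j j \<omega>)"
      using that less_diff_conv[of j d 1] by (simp add: Lmat_def Fract_conv_to_fract)
    then show "valK v (Lmat $$ (i, j)) = ereal_of_enat (v (R i j \<omega>)) - ereal_of_enat (v (R j j \<omega>))"
      using valK_Fract[OF p] by simp
  qed
  have "Min S = - ereal (real h)"
  proof (rule Min_eqI)
    have "S = (\<lambda>(i, j). valK v (L_part d (map_mat to_fract \<omega>) $$ (i, j))) ` ({..<d} \<times> {..<d})"
      by (auto simp: S_def)
    then show "finite S" by simp
    fix y assume "y \<in> S"
    then obtain i j where ij: "i < d" "j < d" "y = valK v (Lmat $$ (i, j))" by (auto simp: S_def L)
    show "- ereal (real h) \<le> y"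
    proof (cases "j < d - 1")
      case jd: True
      obtain m where m: "v (R j j \<omega>) = enat m" using val_finite[OF p[OF ij(1) jd]] by blast
      have "v (R j j \<omega>) - v (R i j \<omega>) \<le> H \<omega>"
        unfolding H_def by (rule SUP_upper2[of "(i, j)"]) (use ij jd in auto)
      then show ?thesis using val[OF ij(1) jd] ij(3) m h by (cases "v (R i j \<omega>)") auto
    next
      case False
      then have "\<not> Suc j < d" by simp
      then show ?thesis using ij val01 by (simp add: Lmat_def)
    qed
  next
    show "- ereal (real h) \<in> S"
    proof (cases "h = 0")
      case True
      \<comment> \<open>For H = 0 the minimum is attained at the entry (0, 0). If d = 1 it lies in
        the trivial last column; otherwise it is the quotient of a nonzero pivot by itself.\<close>
      have "Lmat $$ (0, 0) = 1 \<or> (0 < d - 1 \<and> valK v (Lmat $$ (0, 0)) = 0)"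
      proof (cases "0 < d - 1")
        case True
        then obtain m where "v (R 0 0 \<omega>) = enat m" using val_finite[OF p[of 0 0]] by auto
        then show ?thesis using val[of 0 0] True by simp
      qed (use d in \<open>simp add: Lmat_def\<close>)
      then have "valK v (Lmat $$ (0, 0)) = 0" using val01 by auto
      then show ?thesis
        using d True unfolding S_def L by (intro CollectI exI[of _ "0::nat"]) simp
    next
      case False
      \<comment> \<open>Some truncated difference exceeds h - 1, hence equals h; being positive, it
        agrees with the untruncated one.\<close>
      then have "enat (h - 1) < H \<omega>" by (simp add: h)
      then obtain i j where ij: "i < d" "j < d - 1" "enat (h - 1) < v (R j j \<omega>) - v (R i j \<omega>)"
        unfolding H_def less_SUP_iff by auto
      have "v (R j j \<omega>) - v (R i j \<omega>) \<le> H \<omega>"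
        unfolding H_def by (rule SUP_upper2[of "(i, j)"]) (use ij in auto)
      moreover obtain m where "v (R j j \<omega>) = enat m" using val_finite[OF p[OF ij(1,2)]] by blast
      ultimately have "valK v (Lmat $$ (i, j)) = - ereal (real h)"
        using val[OF ij(1,2)] ij(3) h False by (cases "v (R i j \<omega>)") (auto simp: of_nat_diff)
      moreover have "j < d" using ij by simp
      ultimately show ?thesis
        using ij(1) unfolding S_def L by (intro CollectI exI[of _ i] exI[of _ j]) simp
    qed
  qed
  then show ?thesis
    using True h L_defined_iff_good[OF \<omega>] by (simp add: V_L_def S_def[symmetric])
next
  case False
  then show ?thesis using L_defined_iff_good[OF \<omega>] by (simp add: V_L_def)
qed

section \<open>The loss incurred by looking only at the last row\<close>

definition J :: "'r mat \<Rightarrow> nat" where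
  "J \<omega> = (LEAST j. j < d - 1 \<and> X j \<omega> = Xmax \<omega>)"

text \<open>The default value makes \<open>Y j\<close> measurable for every natural j, as
  composition with the random index \<open>J\<close> requires.\<close>

definition Y :: "nat \<Rightarrow> 'r mat \<Rightarrow> enat" where
  "Y j \<omega> = (if j < d - 1 then v (R (d - 1) j \<omega>) - cont j \<omega> else 0)"

text \<open>
  \<open>Y (J \<omega>) \<omega>\<close> depends on the last row, which is independent of \<open>J\<close> and \<open>Xmax\<close>; \<open>Z\<close> bounds what is lost
  when \<open>H\<close> is estimated by the entry of \<open>L\<close> in the last row and column \<open>J \<omega>\<close>.
\<close>

definition Z :: "'r mat \<Rightarrow> enat" where
  "Z \<omega> = (if good \<omega> \<and> Xmax \<omega> \<noteq> 0 then min (Xmax \<omega>) (Y (J \<omega>) \<omega>) else 0)"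

lemma J_props:
  assumes "Xmax \<omega> \<noteq> 0"
  shows "J \<omega> < d - 1" "X (J \<omega>) \<omega> = Xmax \<omega>"
proof -
  have "{..<d - 1} \<noteq> {}"
  proof
    assume "{..<d - 1} = {}"
    then have "Xmax \<omega> = 0" by (simp only: Xmax_def) (simp add: bot_enat_def)
    with assms show False ..
  qed
  then have "\<exists>j. j < d - 1 \<and> X j \<omega> = Xmax \<omega>"
    using Sup_enat_attained[of "{..<d - 1}" "\<lambda>j. X j \<omega>"] unfolding Xmax_def by blast
  from LeastI_ex[OF this] show "J \<omega> < d - 1" "X (J \<omega>) \<omega> = Xmax \<omega>"
    unfolding J_def by blast+
qed

text \<open>Let x and y be the valuations of the products of row J and of the last row with W_J, and
  c the content of W_J. The truncated difference x - y, which is one of those defining H, equals (x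
  - c) - min(x - c, y - c).\<close>

lemma Xmax_le_H_plus_Z:
  assumes good: "good \<omega>"
  shows "Xmax \<omega> \<le> H \<omega> + Z \<omega>"
proof (cases "Xmax \<omega> = 0")
  case False
  note J = J_props[OF False]
  have d: "d - 1 < d" using J by simp
  have "v (R (J \<omega>) (J \<omega>) \<omega>) - v (R (d - 1) (J \<omega>) \<omega>) \<le> H \<omega>"
    unfolding H_def by (rule SUP_upper2[of "(d - 1, J \<omega>)"]) (use J d in auto)
  moreover have "R (J \<omega>) (J \<omega>) \<omega> \<noteq> 0" using good J by (simp add: good_def)
  then obtain x where "v (R (J \<omega>) (J \<omega>) \<omega>) = enat x" using val_finite by blast
  moreover have "cont (J \<omega>) \<omega> \<noteq> \<infinity>"
    by (rule cont_finite) (use good J in \<open>auto simp: good_def\<close>)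
  then obtain c where "cont (J \<omega>) \<omega> = enat c" by auto
  moreover have "cont (J \<omega>) \<omega> \<le> v (R (d - 1) (J \<omega>) \<omega>)" by (rule cont_le)
  moreover have "Z \<omega> = min (X (J \<omega>) \<omega>) (v (R (d - 1) (J \<omega>) \<omega>) - cont (J \<omega>) \<omega>)"
    using good False J by (simp add: Z_def Y_def)
  ultimately have "X (J \<omega>) \<omega> \<le> H \<omega> + Z \<omega>"
    by (cases "H \<omega>"; cases "v (R (d - 1) (J \<omega>) \<omega>)") (auto simp: X_def)
  then show ?thesis by (simp only: J)
qed simp

lemma measurable_J: "J \<in> measurable \<mu> (count_space UNIV)"
proof -
  have "Measurable.pred \<mu> (\<lambda>\<omega>. j < d - 1 \<and> X j \<omega> = Xmax \<omega>)" for j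
  proof (cases "j < d - 1")
    case True
    have "Measurable.pred \<mu> (\<lambda>\<omega>. X j \<omega> = Xmax \<omega>)"
      by (rule measurable_count_space_binary[where h = "(=)", OF measurable_X measurable_Xmax])
        (use True in simp)
    then show ?thesis using True by simp
  qed simp
  then show ?thesis unfolding J_def by (rule measurable_Least)
qed

lemma measurable_Z: "Z \<in> measurable \<mu> (count_space UNIV)"
proof -
  have Y: "Y j \<in> measurable \<mu> (count_space UNIV)" for j
  proof (cases "j < d - 1")
    case True
    have "(\<lambda>\<omega>. v (R (d - 1) j \<omega>) - cont j \<omega>) \<in> measurable \<mu> (count_space UNIV)"
      by (rule measurable_count_space_binary[where h = "(-)", OF measurable_vR measurable_cont])
        (use True in auto)
    then show ?thesis using True by (simp add: Y_def[abs_def])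
  qed (simp add: Y_def[abs_def])
  have YJ: "(\<lambda>\<omega>. Y (J \<omega>) \<omega>) \<in> measurable \<mu> (count_space UNIV)"
    by (rule measurable_compose_countable[OF Y measurable_J])
  have "(\<lambda>\<omega>. if Xmax \<omega> \<noteq> 0 then min (Xmax \<omega>) (Y (J \<omega>) \<omega>) else 0) \<in> measurable \<mu> (count_space UNIV)"
    by (rule measurable_count_space_binary[where h = "\<lambda>x y. if x \<noteq> 0 then min x y else 0",
          OF measurable_Xmax YJ])
  note measurable_count_space_binary[where h = "\<lambda>g z. if g then z else 0", OF pred_good this]
  moreover have "Z = (\<lambda>\<omega>. if good \<omega> then if Xmax \<omega> \<noteq> 0 then min (Xmax \<omega>) (Y (J \<omega>) \<omega>) else 0 else 0)"
    by (rule ext) (simp add: Z_def)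
  ultimately show ?thesis by (simp only:)
qed

text \<open>Fixing the value j of \<open>J\<close> replaces the random vector by \<open>W j\<close>.
  The event \<open>P j\<close> depends only on the rows before the last, so the condition on the
  last row contributes an independent factor q^(-(t+1)); the events \<open>P j\<close> are
  disjoint.\<close>

lemma measure_Z: "prob {\<omega>\<in>space \<mu>. enat t < Z \<omega>} \<le> prob {\<omega>\<in>space \<mu>. enat t < Xmax \<omega>} / real q ^ Suc t"
proof -
  define P where "P j \<omega> \<longleftrightarrow> good \<omega> \<and> J \<omega> = j \<and> enat t < Xmax \<omega>" for j \<omega>
  define A where "A j = {\<omega>\<in>space \<mu>. P j \<omega> \<and> enat (Suc t) + cont j \<omega> \<le> v (R (d - 1) j \<omega>)}" for j
  have pred_Xmax: "Measurable.pred \<mu> (\<lambda>\<omega>. enat t < Xmax \<omega>)"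
    by (rule measurable_compose[OF measurable_Xmax, where g = "\<lambda>x. enat t < x"]) simp
  have pred_P: "Measurable.pred \<mu> (P j)" for j
    unfolding P_def
    by (intro measurable_count_space_binary[where h = "(\<and>)"] pred_good pred_Xmax)
      (rule measurable_compose[OF measurable_J, where g = "\<lambda>x. x = j"], simp)
  have A_sets: "A j \<in> sets \<mu>" if "j < d - 1" for j
    unfolding A_def
    by (intro predE measurable_count_space_binary[where h = "(\<and>)"] pred_P pred_R_ge)
      (use that in auto)
  have indep: "row_indep (d - 1) (P j)" for j
    unfolding row_indep_def
  proof (intro ballI allI impI)
    fix \<omega> :: "'r mat" and k c assume \<omega>: "\<omega> \<in> carrier_mat d d" and k: "k < d"
    have Req: "R l l (shift (d - 1) k c \<omega>) = R l l \<omega>" if "l < d - 1" for l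
      using row_indep_R[of l "d - 1" l] that \<omega> k by (simp add: row_indep_def)
    have Xeq: "X l (shift (d - 1) k c \<omega>) = X l \<omega>" if "l < d - 1" for l
      using row_indep_X[of l "d - 1"] that \<omega> k by (simp add: row_indep_def)
    have "good (shift (d - 1) k c \<omega>) = good \<omega>" using Req by (simp add: good_def)
    moreover have Xmax: "Xmax (shift (d - 1) k c \<omega>) = Xmax \<omega>"
      using Xeq unfolding Xmax_def by (intro SUP_cong) auto
    moreover have "J (shift (d - 1) k c \<omega>) = J \<omega>"
      unfolding J_def Xmax using Xeq by (metis (no_types, lifting))
    ultimately show "P j (shift (d - 1) k c \<omega>) = P j \<omega>" by (simp add: P_def)
  qed
  have prob_A: "prob (A j) = prob {\<omega>\<in>space \<mu>. P j \<omega>} / real q ^ Suc t" if "j < d - 1" for j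
    unfolding A_def
  proof (rule measure_R[OF _ _ pred_P indep])
    show "R k k \<omega> \<noteq> 0" if "P j \<omega>" "k < j" for \<omega> k
      using that \<open>j < d - 1\<close> by (simp add: P_def good_def)
  qed (use that in auto)
  have "{\<omega>\<in>space \<mu>. enat t < Z \<omega>} \<subseteq> (\<Union>j<d - 1. A j)"
  proof (intro subsetI)
    fix \<omega> assume \<omega>: "\<omega> \<in> {\<omega>\<in>space \<mu>. enat t < Z \<omega>}"
    then have "enat t < Z \<omega>" by simp
    then have good: "good \<omega>" and X0: "Xmax \<omega> \<noteq> 0" and Xt: "enat t < Xmax \<omega>" and Yt: "enat t < Y (J \<omega>) \<omega>"
      by (auto simp: Z_def split: if_splits)
    note J = J_props[OF X0]
    have "cont (J \<omega>) \<omega> \<noteq> \<infinity>"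
      by (rule cont_finite) (use good J in \<open>auto simp: good_def\<close>)
    then have "enat (Suc t) + cont (J \<omega>) \<omega> \<le> v (R (d - 1) (J \<omega>) \<omega>)"
      using Yt J by (simp add: Y_def enat_less_diff_iff)
    then have "\<omega> \<in> A (J \<omega>)" using \<omega> good Xt by (simp add: A_def P_def)
    then show "\<omega> \<in> (\<Union>j<d - 1. A j)" using J by blast
  qed
  then have "prob {\<omega>\<in>space \<mu>. enat t < Z \<omega>} \<le> prob (\<Union>j<d - 1. A j)"
    using A_sets by (intro finite_measure_mono sets.finite_UN) auto
  also have "\<dots> \<le> (\<Sum>j<d - 1. prob (A j))"
    using A_sets by (intro finite_measure_subadditive_finite) auto
  also have "\<dots> = (\<Sum>j<d - 1. prob {\<omega>\<in>space \<mu>. P j \<omega>}) / real q ^ Suc t"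
    using prob_A by (simp add: sum_divide_distrib)
  also have "(\<Sum>j<d - 1. prob {\<omega>\<in>space \<mu>. P j \<omega>}) = prob (\<Union>j<d - 1. {\<omega>\<in>space \<mu>. P j \<omega>})"
    using predE[OF pred_P]
    by (intro finite_measure_finite_Union[symmetric]) (auto simp: disjoint_family_on_def P_def simp del: space_\<mu>)
  also have "\<dots> \<le> prob {\<omega>\<in>space \<mu>. enat t < Xmax \<omega>}"
    by (rule finite_measure_mono[OF _ predE[OF pred_Xmax]]) (auto simp: P_def)
  finally show ?thesis using q_ge_2 by (simp add: divide_right_mono)
qed

text \<open>
  On this event column \<open>0\<close> attains \<open>Xmax\<close> and row \<open>1\<close> already yields \<open>H = Xmax\<close>, whereas \<open>Z > 0\<close>.
  It needs row \<open>1\<close> to differ from the last row: for \<open>d = 2\<close> the lower bound is an equality.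
\<close>

definition strict_event :: "'r mat \<Rightarrow> bool" where
  "strict_event \<omega> \<longleftrightarrow> (((R 0 0 \<omega> \<noteq> 0 \<and> enat 2 + cont 0 \<omega> \<le> v (R 0 0 \<omega>))
      \<and> \<not> enat 1 + cont 0 \<omega> \<le> v (R 1 0 \<omega>) \<and> \<not> enat 2 + cont 1 \<omega> \<le> v (R 1 1 \<omega>))
      \<and> (\<forall>i<d - 1. 2 \<le> i \<longrightarrow> X i \<omega> \<le> enat 1))
      \<and> enat 1 + cont 0 \<omega> \<le> v (R (d - 1) 0 \<omega>)"

lemma strict_event_less:
  assumes d: "d \<ge> 3" and ev: "strict_event \<omega>"
  shows "good \<omega>" "Xmax \<omega> < H \<omega> + Z \<omega>"
proof -
  have R00: "R 0 0 \<omega> \<noteq> 0" using ev unfolding strict_event_def by blast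
  have c0: "cont 0 \<omega> \<noteq> \<infinity>" by (rule cont_finite) (use d in auto)
  have c1: "cont 1 \<omega> \<noteq> \<infinity>" by (rule cont_finite) (use d R00 in auto)
  have "enat 2 + cont 0 \<omega> \<le> v (R 0 0 \<omega>)" using ev unfolding strict_event_def by blast
  then have X0: "enat 1 < X 0 \<omega>"
    using enat_less_diff_iff[OF c0, of 1] by (simp add: X_def numeral_2_eq_2)
  have "\<not> enat 2 + cont 1 \<omega> \<le> v (R 1 1 \<omega>)" using ev unfolding strict_event_def by blast
  then have "\<not> enat 1 < X 1 \<omega>" unfolding X_def enat_less_diff_iff[OF c1] Suc_1 .
  then have X1: "X 1 \<omega> \<le> enat 1" by (simp only: not_less)
  have Xi: "X i \<omega> \<le> enat 1" if "0 < i" "i < d - 1" for i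
  proof (cases "i = 1")
    case False
    then have "2 \<le> i" using that by simp
    then show ?thesis using ev that unfolding strict_event_def by blast
  qed (use X1 in simp)
  show good: "good \<omega>"
    unfolding good_def
  proof (intro allI impI)
    fix j assume j: "j < d - 1"
    show "R j j \<omega> \<noteq> 0"
    proof (cases "j = 0")
      case False
      then show ?thesis using Xi[of j] j X_infinite[of j \<omega>] by auto
    qed (use R00 in simp)
  qed
  have Xmax: "Xmax \<omega> = X 0 \<omega>"
  proof (rule antisym)
    show "Xmax \<omega> \<le> X 0 \<omega>"
      unfolding Xmax_def
    proof (rule SUP_least)
      fix i assume "i \<in> {..<d - 1}"
      then show "X i \<omega> \<le> X 0 \<omega>" using Xi[of i] X0 by (cases "i = 0") auto
    qed
    show "X 0 \<omega> \<le> Xmax \<omega>" unfolding Xmax_def by (rule SUP_upper) (use d in simp)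
  qed
  have J: "J \<omega> = 0"
    unfolding J_def by (rule Least_equality) (use d Xmax in auto)
  have "cont 0 \<omega> \<le> v (R 1 0 \<omega>)" by (rule cont_le)
  moreover have "\<not> enat 1 + cont 0 \<omega> \<le> v (R 1 0 \<omega>)"
    using ev unfolding strict_event_def by blast
  ultimately have "v (R 1 0 \<omega>) = cont 0 \<omega>" using c0 by (cases "v (R 1 0 \<omega>)") auto
  moreover have "v (R 0 0 \<omega>) - v (R 1 0 \<omega>) \<le> H \<omega>"
    unfolding H_def by (rule SUP_upper2[of "(1, 0)"]) (use d in auto)
  ultimately have H: "Xmax \<omega> \<le> H \<omega>" by (simp add: Xmax X_def)
  have "enat 1 + cont 0 \<omega> \<le> v (R (d - 1) 0 \<omega>)" using ev unfolding strict_event_def by blast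
  then have "enat 0 < Y 0 \<omega>"
    using enat_less_diff_iff[OF c0, of 0] d by (simp add: Y_def)
  moreover have "Xmax \<omega> \<noteq> 0" using X0 Xmax by auto
  moreover have "enat 0 < Xmax \<omega>" using X0 unfolding Xmax by (rule less_trans[rotated]) simp
  ultimately have "0 < Z \<omega>" using good J by (simp add: Z_def zero_enat_def)
  with H Xmax_finite[OF good] show "Xmax \<omega> < H \<omega> + Z \<omega>"
    by (cases "H \<omega>"; cases "Z \<omega>"; cases "Xmax \<omega>") (auto simp: zero_enat_def)
qed

text \<open>The conditions are imposed row by row: \<open>P1\<close> concerns row 0,
  \<open>P2\<close> adds row 1, \<open>P3\<close> adds the rows from 2 up to the one before the
  last, and the last row comes at the end. Each stage keeps a positive proportion of the preceding
  event.\<close>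

lemma strict_event_sets: "d \<ge> 3 \<Longrightarrow> {\<omega>\<in>space \<mu>. strict_event \<omega>} \<in> sets \<mu>"
  and strict_event_pos: "d \<ge> 3 \<Longrightarrow> prob {\<omega>\<in>space \<mu>. strict_event \<omega>} > 0"
proof -
  assume d: "d \<ge> 3"
  define P1 where "P1 \<omega> \<longleftrightarrow> R 0 0 \<omega> \<noteq> 0 \<and> enat 2 + cont 0 \<omega> \<le> v (R 0 0 \<omega>)" for \<omega>
  define P2 where "P2 \<omega> \<longleftrightarrow> P1 \<omega> \<and> \<not> enat 1 + cont 0 \<omega> \<le> v (R 1 0 \<omega>) \<and> \<not> enat 2 + cont 1 \<omega> \<le> v (R 1 1 \<omega>)" for \<omega>
  define P3 where "P3 \<omega> \<longleftrightarrow> P2 \<omega> \<and> (\<forall>i<d - 1. 2 \<le> i \<longrightarrow> X i \<omega> \<le> enat 1)" for \<omega>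
  note pred_and = measurable_count_space_binary[where h = "(\<and>)"]
  have "Measurable.pred \<mu> (\<lambda>\<omega>. v (R 0 0 \<omega>) \<noteq> \<infinity>)"
    by (rule measurable_compose[OF measurable_vR, where g = "\<lambda>x. x \<noteq> \<infinity>"]) (use d in auto)
  then have R00: "Measurable.pred \<mu> (\<lambda>\<omega>. R 0 0 \<omega> \<noteq> 0)" by (simp only: val_eq_infinity)
  have pred1: "Measurable.pred \<mu> P1"
    unfolding P1_def by (intro pred_and R00 pred_R_ge) (use d in auto)
  have pred2: "Measurable.pred \<mu> P2"
    unfolding P2_def
    by (intro pred_and pred1 pred_R_ge measurable_compose[OF pred_R_ge, where g = Not]) (use d in auto)
  have pred3: "Measurable.pred \<mu> P3"
    unfolding P3_def by (intro pred_and pred2 pred_X_le_all) (use d in auto)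
  have ev: "strict_event = (\<lambda>\<omega>. P3 \<omega> \<and> enat 1 + cont 0 \<omega> \<le> v (R (d - 1) 0 \<omega>))"
    unfolding strict_event_def P3_def P2_def P1_def by blast
  show "{\<omega>\<in>space \<mu>. strict_event \<omega>} \<in> sets \<mu>"
    unfolding ev by (intro predE pred_and pred3 pred_R_ge) (use d in auto)
  \<comment> \<open>Given \<open>P1\<close>, the two conditions on row 1 fail with these
    probabilities. The second threshold is 2 because the threshold 1 would give 1/2 + 1/2 when q =
    2.\<close>
  have q: "1 / real q + 1 / real q ^ 2 < 1"
  proof -
    have "1 / real q \<le> 1 / 2" using q_ge_2 by (simp add: field_simps)
    moreover have "1 / real q ^ 2 \<le> 1 / 2 ^ 2"
      using q_ge_2 by (intro divide_left_mono power_mono) auto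
    ultimately show ?thesis by simp
  qed
  have indep1: "row_indep i P1" if "1 \<le> i" for i
    using row_indep_R[of 0 i 0] row_indep_cont[of 0 i] that d by (simp add: P1_def row_indep_def)
  have indep2: "row_indep i P2" if "2 \<le> i" for i
    using indep1[of i] row_indep_R[of 0 i 1] row_indep_R[of 1 i 1] row_indep_cont[of 0 i]
      row_indep_cont[of 1 i] that d by (simp add: P2_def row_indep_def)
  have indep3: "row_indep (d - 1) P3"
  proof -
    have "X i (shift (d - 1) k c \<omega>) = X i \<omega>" if "\<omega> \<in> carrier_mat d d" "k < d" "i < d - 1" for i k c \<omega>
      using row_indep_X[of i "d - 1"] that by (simp add: row_indep_def)
    moreover have "P2 (shift (d - 1) k c \<omega>) = P2 \<omega>" if "\<omega> \<in> carrier_mat d d" "k < d" for k c \<omega>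
      using indep2[of "d - 1"] that d by (simp add: row_indep_def)
    ultimately show ?thesis unfolding row_indep_def P3_def by (metis (no_types, lifting))
  qed
  \<comment> \<open>The condition that \<open>R 0 0 \<omega>\<close> is nonzero, which makes
    \<open>W 1\<close> nonzero, holds almost surely and does not change the probability.\<close>
  have "prob {\<omega>\<in>space \<mu>. P1 \<omega>}
      = prob {\<omega>\<in>space \<mu>. True \<and> enat 2 + cont 0 \<omega> \<le> v (R 0 0 \<omega>)}"
  proof (rule finite_measure_eq_AE)
    have "AE \<omega> in \<mu>. R 0 0 \<omega> \<noteq> 0"
      using AE_good by eventually_elim (use d in \<open>auto simp: good_def\<close>)
    then show "AE \<omega> in \<mu>. (\<omega> \<in> {\<omega>\<in>space \<mu>. P1 \<omega>})
        = (\<omega> \<in> {\<omega>\<in>space \<mu>. True \<and> enat 2 + cont 0 \<omega> \<le> v (R 0 0 \<omega>)})"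
      by eventually_elim (simp add: P1_def)
    show "{\<omega>\<in>space \<mu>. True \<and> enat 2 + cont 0 \<omega> \<le> v (R 0 0 \<omega>)} \<in> sets \<mu>"
      by (intro predE pred_and pred_R_ge) (use d in auto)
  qed (rule predE[OF pred1])
  also have "\<dots> = prob {\<omega>\<in>space \<mu>. True} / real q ^ 2"
    by (rule measure_R) (use d in \<open>auto simp: row_indep_def\<close>)
  finally have p1: "prob {\<omega>\<in>space \<mu>. P1 \<omega>} > 0"
    using q_ge_2 prob_space by simp
  define A where "A = {\<omega>\<in>space \<mu>. P1 \<omega> \<and> enat 1 + cont 0 \<omega> \<le> v (R 1 0 \<omega>)}"
  define B where "B = {\<omega>\<in>space \<mu>. P1 \<omega> \<and> enat 2 + cont 1 \<omega> \<le> v (R 1 1 \<omega>)}"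
  have A_sets: "A \<in> sets \<mu>" and B_sets: "B \<in> sets \<mu>"
    unfolding A_def B_def by (intro predE pred_and pred1 pred_R_ge; use d in simp)+
  have A: "prob A = prob {\<omega>\<in>space \<mu>. P1 \<omega>} / real q ^ 1"
    unfolding A_def by (rule measure_R[OF _ _ pred1 indep1]) (use d in auto)
  have B: "prob B = prob {\<omega>\<in>space \<mu>. P1 \<omega>} / real q ^ 2"
    unfolding B_def by (rule measure_R[OF _ _ pred1 indep1]) (use d in \<open>auto simp: P1_def\<close>)
  have "prob {\<omega>\<in>space \<mu>. P2 \<omega>} = prob ({\<omega>\<in>space \<mu>. P1 \<omega>} - (A \<union> B))"
    by (rule arg_cong[where f = prob]) (auto simp: P2_def A_def B_def)
  also have "\<dots> = prob {\<omega>\<in>space \<mu>. P1 \<omega>} - prob (A \<union> B)"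
    by (rule finite_measure_Diff) (use predE[OF pred1] A_sets B_sets in \<open>auto simp: A_def B_def\<close>)
  also have "prob (A \<union> B) \<le> prob A + prob B"
    by (rule measure_Un_le[OF A_sets B_sets])
  then have "prob {\<omega>\<in>space \<mu>. P1 \<omega>} - prob (A \<union> B)
      \<ge> prob {\<omega>\<in>space \<mu>. P1 \<omega>} * (1 - (1 / real q + 1 / real q ^ 2))"
    by (simp add: A B algebra_simps)
  finally have p2: "prob {\<omega>\<in>space \<mu>. P2 \<omega>} > 0"
    using mult_pos_pos[OF p1, of "1 - (1 / real q + 1 / real q ^ 2)"] q by linarith
  have "prob {\<omega>\<in>space \<mu>. P3 \<omega>}
      = prob {\<omega>\<in>space \<mu>. P2 \<omega>} * (1 - 1 / real q ^ Suc 1) ^ (d - 1 - 2)"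
    unfolding P3_def
  proof (rule measure_X_le_all[OF pred2 indep2])
    fix \<omega> and i :: nat assume "P2 \<omega>" "i < 2"
    then have "R 0 0 \<omega> \<noteq> 0" "R 1 1 \<omega> \<noteq> 0" by (auto simp: P2_def P1_def)
    then show "R i i \<omega> \<noteq> 0" using \<open>i < 2\<close> by (auto simp: less_2_cases_iff)
  qed (use d in auto)
  then have p3: "prob {\<omega>\<in>space \<mu>. P3 \<omega>} > 0"
    using p2 tail_bounds[of 1] by (simp only: mult_pos_pos zero_less_power diff_gt_0_iff_gt)
  have "prob {\<omega>\<in>space \<mu>. strict_event \<omega>} = prob {\<omega>\<in>space \<mu>. P3 \<omega>} / real q ^ 1"
    unfolding ev by (rule measure_R[OF _ _ pred3 indep3]) (use d in auto)
  then show "prob {\<omega>\<in>space \<mu>. strict_event \<omega>} > 0" using p3 q_ge_2 by simp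
qed

section \<open>Bounds for the expectation\<close>

lemma expectation_V_L:
  assumes d: "d \<ge> 1"
  shows "integrable \<mu> (V_L v d)" "expectation (V_L v d) \<le> E q d"
    and "E q d - 1 / (real q - 1) \<le> expectation (V_L v d)"
    and "d \<ge> 3 \<Longrightarrow> E q d - 1 / (real q - 1) < expectation (V_L v d)"
proof -
  define u where "u t = 1 / real q ^ Suc t" for t
  define g where "g t = 1 - (1 - u t) ^ (d - 1)" for t
  have u: "0 < u t" "u t < 1" for t using tail_bounds[of t] by (simp_all only: u_def)
  have summ_Ed: "summable (\<lambda>t. 1 - (1 - u t) ^ d)"
    using E_bounds(1)[OF q_ge_2 d] by (simp only: u_def)
  have Ed: "E q d = (\<Sum>t. 1 - (1 - u t) ^ d)" by (simp only: E_def u_def)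
  \<comment> \<open>Only d - 1 columns of L vary; raising the exponent from d - 1 to d gives the
    upper bound \<open>E q d\<close>.\<close>
  have g_nonneg: "0 \<le> g t" and g_le: "g t \<le> 1 - (1 - u t) ^ d" for t
  proof -
    show "0 \<le> g t" using u[of t] by (simp add: g_def power_le_one)
    show "g t \<le> 1 - (1 - u t) ^ d" using u[of t] power_decreasing[of "d - 1" d "1 - u t"] by (simp add: g_def)
  qed
  have g: "summable g"
    by (rule summable_comparison_test'[OF summ_Ed]) (use g_nonneg g_le in auto)
  have gu: "summable (\<lambda>t. g t * u t)"
    by (rule summable_comparison_test'[OF g]) (use g_nonneg u in \<open>auto simp: abs_mult less_imp_le intro!: mult_left_le\<close>)
  have usum: "u sums (1 / (real q - 1))"
  proof -
    have "(\<lambda>t. (1 / real q) ^ t) sums (1 / (1 - 1 / real q))"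
      using q_ge_2 by (intro geometric_sums) auto
    from sums_mult[OF this, of "1 / real q"] have "u sums (1 / real q * (1 / (1 - 1 / real q)))"
      by (simp add: u_def[abs_def] power_one_over)
    moreover have "1 / real q * (1 / (1 - 1 / real q)) = 1 / (real q - 1)"
      using q_ge_2 by (simp add: divide_simps)
    ultimately show ?thesis by simp
  qed
  \<comment> \<open>Termwise, 1 - (1 - u)^d - u = (1 - u) (1 - (1 - u)^(d-1)): the tail of
    \<open>Xmax\<close> minus the bound for the tail of \<open>Z\<close>.\<close>
  have lower: "E q d - 1 / (real q - 1) = (\<Sum>t. g t) - (\<Sum>t. g t * u t)"
  proof -
    have "(1 - u t) ^ d = (1 - u t) * (1 - u t) ^ (d - 1)" for t
      using d by (simp add: power_eq_if)
    then have eq: "1 - (1 - u t) ^ d - u t = g t - g t * u t" for t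
      by (simp add: g_def algebra_simps)
    have "E q d - 1 / (real q - 1) = (\<Sum>t. 1 - (1 - u t) ^ d - u t)"
      unfolding Ed sums_unique[OF usum] by (rule suminf_diff[OF summ_Ed sums_summable[OF usum]])
    also have "\<dots> = (\<Sum>t. g t) - (\<Sum>t. g t * u t)"
      unfolding eq by (rule suminf_diff[OF g gu, symmetric])
    finally show ?thesis .
  qed
  have fin: "Xmax \<omega> \<noteq> \<infinity>" "H \<omega> \<noteq> \<infinity>" "Z \<omega> \<noteq> \<infinity>" if "good \<omega>" for \<omega>
  proof -
    show X: "Xmax \<omega> \<noteq> \<infinity>" by (rule Xmax_finite[OF that])
    show "H \<omega> \<noteq> \<infinity>" using H_le_Xmax[of \<omega>] X by (metis infinity_ileE not_infinity_eq)
    have "Z \<omega> \<le> Xmax \<omega>" by (simp add: Z_def)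
    then show "Z \<omega> \<noteq> \<infinity>" using X by (metis infinity_ileE not_infinity_eq)
  qed
  have AE_fin: "AE \<omega> in \<mu>. Xmax \<omega> \<noteq> \<infinity>" "AE \<omega> in \<mu>. H \<omega> \<noteq> \<infinity>" "AE \<omega> in \<mu>. Z \<omega> \<noteq> \<infinity>"
    by (rule eventually_mono[OF AE_good], rule fin, assumption)+
  have tailX: "prob {\<omega>\<in>space \<mu>. enat t < Xmax \<omega>} = g t" for t
    unfolding measure_Xmax g_def u_def ..
  have tailH: "prob {\<omega>\<in>space \<mu>. enat t < H \<omega>} \<le> g t" for t
    unfolding tailX[symmetric]
    by (rule finite_measure_mono[OF _ predE[OF measurable_compose[OF measurable_Xmax, where g = "\<lambda>x. enat t < x"]]])
      (use H_le_Xmax in \<open>auto intro: less_le_trans\<close>)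
  have tailZ: "prob {\<omega>\<in>space \<mu>. enat t < Z \<omega>} \<le> g t * u t" for t
    using measure_Z[of t] unfolding tailX u_def by simp
  note IX = integral_enat[OF measurable_Xmax AE_fin(1) eq_refl[OF tailX] g]
  note IH = integral_enat[OF measurable_H AE_fin(2) tailH g]
  note IZ = integral_enat[OF measurable_Z AE_fin(3) tailZ gu]
  have meas: "V_L v d \<in> borel_measurable \<mu>"
  proof -
    have "(\<lambda>\<omega>. if good \<omega> then the_enat (H \<omega>) else 0) \<in> measurable \<mu> (count_space UNIV)"
      by (rule measurable_count_space_binary[where h = "\<lambda>b x. if b then the_enat x else 0",
            OF pred_good measurable_H])
    from measurable_compose[OF this, where g = real]
    have "(\<lambda>\<omega>. real (if good \<omega> then the_enat (H \<omega>) else 0)) \<in> borel_measurable \<mu>" by simp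
    then show ?thesis
      by (rule measurable_cong[THEN iffD1, rotated]) (simp add: V_L_eq[OF d])
  qed
  have AE_V: "AE \<omega> in \<mu>. real (the_enat (H \<omega>)) = V_L v d \<omega>"
    using AE_good AE_space by eventually_elim (simp add: V_L_eq[OF d])
  show "integrable \<mu> (V_L v d)"
    using integrable_cong_AE_imp[OF IH(1) meas] AE_V by auto
  have V: "expectation (V_L v d) = expectation (\<lambda>\<omega>. real (the_enat (H \<omega>)))"
    by (rule integral_cong_AE[OF meas borel_measurable_integrable[OF IH(1)]])
      (use AE_V in \<open>auto elim: eventually_mono\<close>)
  show "expectation (V_L v d) \<le> E q d"
    unfolding V Ed using IH(3) suminf_le[OF g_le g summ_Ed] by linarith
  have EX: "expectation (\<lambda>\<omega>. real (the_enat (Xmax \<omega>))) = (\<Sum>t. g t)"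
    unfolding IX(2) tailX ..
  have le: "real (the_enat (Xmax \<omega>)) \<le> real (the_enat (H \<omega>)) + real (the_enat (Z \<omega>))"
    if "good \<omega>" for \<omega>
    using Xmax_le_H_plus_Z[OF that] fin[OF that] by auto
  have AE_le: "AE \<omega> in \<mu>. real (the_enat (Xmax \<omega>)) \<le> real (the_enat (H \<omega>)) + real (the_enat (Z \<omega>))"
    by (rule eventually_mono[OF AE_good], rule le)
  have "(\<Sum>t. g t) \<le> expectation (\<lambda>\<omega>. real (the_enat (H \<omega>)) + real (the_enat (Z \<omega>)))"
    unfolding EX[symmetric] using IX(1) IH(1) IZ(1) AE_le by (intro integral_mono_AE) auto
  then show "E q d - 1 / (real q - 1) \<le> expectation (V_L v d)"
    unfolding lower V using IZ(3) by (simp add: Bochner_Integration.integral_add[OF IH(1) IZ(1)])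
  show "E q d - 1 / (real q - 1) < expectation (V_L v d)" if d3: "d \<ge> 3"
  proof -
    have "expectation (\<lambda>\<omega>. real (the_enat (Xmax \<omega>)))
        < expectation (\<lambda>\<omega>. real (the_enat (H \<omega>)) + real (the_enat (Z \<omega>)))"
    proof (rule integral_less_AE[OF IX(1) _ _ strict_event_sets[OF d3] _ AE_le])
      show "integrable \<mu> (\<lambda>\<omega>. real (the_enat (H \<omega>)) + real (the_enat (Z \<omega>)))"
        using IH(1) IZ(1) by simp
      show "emeasure \<mu> {\<omega>\<in>space \<mu>. strict_event \<omega>} \<noteq> 0"
        using strict_event_pos[OF d3] by (simp add: emeasure_eq_measure del: space_\<mu>)
      have "real (the_enat (Xmax \<omega>)) \<noteq> real (the_enat (H \<omega>)) + real (the_enat (Z \<omega>))"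
        if "strict_event \<omega>" for \<omega>
        using strict_event_less(2)[OF d3 that] fin[OF strict_event_less(1)[OF d3 that]] by auto
      then show "AE \<omega> in \<mu>. \<omega> \<in> {\<omega>\<in>space \<mu>. strict_event \<omega>} \<longrightarrow>
          real (the_enat (Xmax \<omega>)) \<noteq> real (the_enat (H \<omega>)) + real (the_enat (Z \<omega>))"
        by (intro AE_I2) auto
    qed
    then show ?thesis
      unfolding EX lower V using IZ(3) by (simp add: Bochner_Integration.integral_add[OF IH(1) IZ(1)])
  qed
qed

end

text \<open>Strictness of the lower bound begins at d = 3: for d = 1 both sides are 0, and for d = 2
  both are 1/(q-1) - 1/(q^2-1).\<close>

theorem theorem1p1:
  fixes v :: "'r::idom \<Rightarrow> enat" and q d :: nat and \<mu> :: "'r mat measure"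
  assumes "complete_dvr v"
    and "finite (residue_field v)" and "card (residue_field v) = q"
    and "d \<ge> 1"
    and "haar_prob v d \<mu>"
  shows "(AE \<omega> in \<mu>. L_defined d (map_mat to_fract \<omega>))
    \<and> integrable \<mu> (V_L v d)
    \<and> E q d - 1 / (real q - 1) \<le> integral\<^sup>L \<mu> (V_L v d)
    \<and> (d \<ge> 3 \<longrightarrow> E q d - 1 / (real q - 1) < integral\<^sup>L \<mu> (V_L v d))
    \<and> integral\<^sup>L \<mu> (V_L v d) \<le> E q d
    \<and> \<bar>E q d - log (real q) (real d)\<bar> \<le> 1 / ln 2
    \<and> (q \<ge> 3 \<longrightarrow> \<bar>E q d - log (real q) (real d)\<bar> \<le> 1)"
proof -
  interpret haar_dvr v q d \<mu>
    using assms by (simp add: haar_dvr_def haar_dvr_axioms_def)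
  have "AE \<omega> in \<mu>. L_defined d (map_mat to_fract \<omega>)"
    using AE_good AE_space by eventually_elim (simp add: L_defined_iff_good)
  \<comment> \<open>The errors are 1 below and 1 / ln q above; both are at most 1 / ln 2, and for q
    \<ge> 3 both are at most 1 because e < 3.\<close>
  moreover have ln2: "1 \<le> 1 / ln (2::real)" using ln_2_less_1 by (simp add: field_simps)
  moreover have "ln 2 \<le> ln (real q)" using q_ge_2 by simp
  then have "1 / ln (real q) \<le> 1 / ln 2" using q_ge_2 by (intro divide_left_mono) auto
  then have "\<bar>E q d - log q d\<bar> \<le> 1 / ln 2"
    using E_bounds(2,3)[OF q_ge_2 assms(4)] ln2 by linarith
  moreover have "\<bar>E q d - log q d\<bar> \<le> 1" if "q \<ge> 3"
  proof -
    have "exp 1 < real q" using that e_less_272 by simp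
    then have "1 \<le> ln (real q)" by (metis less_imp_le exp_gt_zero less_trans ln_exp ln_less_cancel_iff)
    then have "1 / ln (real q) \<le> 1" by simp
    then show ?thesis using E_bounds(2,3)[OF q_ge_2 assms(4)] by linarith
  qed
  ultimately show ?thesis using expectation_V_L[OF assms(4)] by blast
qed

end
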